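(* Let $s$, $t$, $m$, $n$ be positive integers with $n\geq m$. Then $$\hat{r}(sK_{1,n}, tK_{1,m})=(s+t-1)(m+n-1).$$ Moreover, if $G\rightarrow(sK_{1,n},tK_{1,m})$ and $e(G)=(s+t-1)(m+n-1)$, then one of the following holds: $G=(s+t-1)K_{1,n+m-1}$; or $n=m=2$ and $G=lK_3\sqcup (s+t-l-1)K_{1,3}$ for some nonnegative integer $l$; or $s=m=1$, $n=2$ and $G=lC_4\sqcup (t-2l)K_{1,2}$ for some nonnegative integer $l$.
   Context: All graphs are undirected, simple, finite and without isolated vertices. Equality of graphs means isomorphism. $e(G)$ denotes the number of edges of $G$. $K_{1,n}$ is the star with one root vertex joined to $n$ leaves, $K_3$ is the triangle, and $C_4$ is the cycle on four vertices. $G\sqcup H$ is the disjoint union of $G$ and $H$, and $kG$ is the disjoint union of $k$ copies of $G$. For graphs $F_1,F_2,G$, write $G\rightarrow(F_1,F_2)$ if for every coloring of the edges of $G$ by red and blue there is either a red copy of $F_1$ or a blue copy of $F_2$ in $G$ (copies are subgraphs, not necessarily induced). The size Ramsey number $\hat{r}(F_1,F_2)$ is the minimum number of edges of a graph $G$ such that $G\rightarrow(F_1,F_2)$. *)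

theory Defs
  imports "HOL-Library.Extended_Nat"
begin

record 'a ugraph =
  verts :: "'a set"
  edges :: "'a set set"

definition simple_graph :: "'a ugraph \<Rightarrow> bool" where
  "simple_graph G \<longleftrightarrow>
     finite (verts G) \<and>
     (\<forall>e\<in>edges G. e \<subseteq> verts G \<and> card e = 2) \<and>
     (\<forall>v\<in>verts G. \<exists>e\<in>edges G. v \<in> e)"  (* no isolated vertices; the empty graph is allowed *)

definition isomorphic :: "'a ugraph \<Rightarrow> 'b ugraph \<Rightarrow> bool" (infix \<open>\<simeq>\<close> 50) where
  "G \<simeq> H \<longleftrightarrow> (\<exists>f. bij_betw f (verts G) (verts H) \<and> (\<lambda>e. f ` e) ` edges G = edges H)"

definition subgraph :: "'a ugraph \<Rightarrow> 'a ugraph \<Rightarrow> bool" where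
  "subgraph H G \<longleftrightarrow> simple_graph H \<and> verts H \<subseteq> verts G \<and> edges H \<subseteq> edges G"

definition star_graph :: "nat \<Rightarrow> nat ugraph" where
  "star_graph n = \<lparr>verts = {0..n}, edges = {{0, i} | i. i \<in> {1..n}}\<rparr>"

definition complete_graph :: "nat \<Rightarrow> nat ugraph" where
  "complete_graph k = \<lparr>verts = {..<k}, edges = {e. e \<subseteq> {..<k} \<and> card e = 2}\<rparr>"

definition cycle_graph :: "nat \<Rightarrow> nat ugraph" where  (* meant for k at least 3 *)
  "cycle_graph k = \<lparr>verts = {..<k}, edges = {{i, Suc i mod k} | i. i < k}\<rparr>"

definition disjoint_union :: "'a ugraph \<Rightarrow> 'b ugraph \<Rightarrow> ('a + 'b) ugraph" (infixr \<open>\<squnion>\<^sub>g\<close> 65) where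
  "G \<squnion>\<^sub>g H =
     \<lparr>verts = Inl ` verts G \<union> Inr ` verts H,
      edges = (\<lambda>e. Inl ` e) ` edges G \<union> (\<lambda>e. Inr ` e) ` edges H\<rparr>"

definition copies :: "nat \<Rightarrow> 'a ugraph \<Rightarrow> (nat \<times> 'a) ugraph" where
  "copies k G =
     \<lparr>verts = {..<k} \<times> verts G,
      edges = {Pair i ` e | i e. i < k \<and> e \<in> edges G}\<rparr>"

datatype colour = Red | Blue

definition mono_copy :: "'a ugraph \<Rightarrow> ('a set \<Rightarrow> colour) \<Rightarrow> colour \<Rightarrow> 'b ugraph \<Rightarrow> bool" where
  "mono_copy G c col F \<longleftrightarrow> (\<exists>H. subgraph H G \<and> (\<forall>e\<in>edges H. c e = col) \<and> H \<simeq> F)"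

definition arrows :: "'a ugraph \<Rightarrow> 'b ugraph \<Rightarrow> 'c ugraph \<Rightarrow> bool" where
  "arrows G F1 F2 \<longleftrightarrow> (\<forall>c. mono_copy G c Red F1 \<or> mono_copy G c Blue F2)"

(* Vertices in nat are no restriction: every finite graph is isomorphic to such a graph.
   With values in enat the infimum over no graph at all is infinite, and a finite value is a
   minimum, i.e. it is attained. *)
definition size_ramsey :: "'b ugraph \<Rightarrow> 'c ugraph \<Rightarrow> enat" where
  "size_ramsey F1 F2 =
     (INF G \<in> {G :: nat ugraph. simple_graph G \<and> arrows G F1 F2}. enat (card (edges G)))"

end

theory Submission
  imports Defs Complex_Main
begin

text \<open>
  Put \<open>a = n - 1\<close>, \<open>b = m - 1\<close> and \<open>k = a + b + 1 = m + n - 1\<close>. If some set \<open>U\<close> of at most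
  \<open>s + t - 2\<close> vertices leaves a graph \<open>G - U\<close> whose edges split into a red part of maximum degree at
  most \<open>a\<close> and a blue part of maximum degree at most \<open>b\<close>, then \<open>G\<close> does not arrow the pair of star
  forests: colour red the edges at \<open>s - 1\<close> vertices of \<open>U\<close>, blue the remaining edges at the other
  \<open>t - 1\<close>, and split the rest. Every red \<open>K\<^bsub>1,n\<^esub>\<close> then uses one of the first \<open>s - 1\<close> vertices and
  every blue \<open>K\<^bsub>1,m\<^esub>\<close> one of the other \<open>t - 1\<close>. So an arrowing graph is robust: the deletion of fewer
  than \<open>N = s + t - 1\<close> vertices never makes it split. The lower bound is that a robust graph has at
  least \<open>N k\<close> edges (\<open>robust_card_ge\<close>).

  A vertex of degree at least \<open>k\<close> can be deleted at the expense of \<open>k\<close> edges, so let all degrees be at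
  most \<open>a + b\<close>. If \<open>b = 0\<close> the graph splits. Otherwise take a smallest set \<open>U\<close> whose deletion makes it
  split, and among the splittings of the rest one with as many vertices as possible that have room
  for a further edge of either colour. No vertex \<open>x\<close> of \<open>U\<close> can be put back. Since each neighbour of \<open>x\<close>
  outside \<open>U\<close> has room for a further edge of some colour, this means that more than \<open>a\<close> of these
  neighbours are saturated in blue or more than \<open>b\<close> of them in red (\<open>saturated_nbrs\<close>). Suppose that
  \<open>w\<close> is saturated in blue. If \<open>w\<close> has room for two red edges, then no blue edge joins \<open>w\<close> to another
  blue-saturated vertex with room for a red edge, for such an edge could be recoloured
  (\<open>recolour_edge\<close>); if \<open>w\<close> has room for one red edge only, then \<open>w\<close> has at most one neighbour in \<open>U\<close>.
  The same holds with the colours exchanged. So few edges at saturated vertices are counted twice,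
  and a suitable distribution of the edges among the vertices of \<open>U\<close> shows
  \<open>|E| \<ge> k |U|\<close> (\<open>smallest_deletion_set\<close>), where equality with \<open>U\<close> nonempty forces \<open>a = b = 1\<close> and a
  disjoint union of triangles (\<open>triangle_decomposition\<close>).

  In case of equality \<open>|E| = N k\<close> no degree exceeds \<open>k\<close>, and the deletion of any vertex \<open>v\<close> of degree \<open>k\<close>
  leaves an extremal graph, which by induction is a disjoint union of pieces. If \<open>v\<close> is joined to a
  leaf of a star, then deleting this leaf instead of both centres leaves a graph that splits
  (\<open>shared_leaf_splits\<close>), unless \<open>a = 1\<close>, \<open>b = 0\<close> and \<open>v\<close> closes a four-cycle; if \<open>v\<close> is joined to a
  triangle, it completes a \<open>K\<^sub>4\<close>. So the pieces are stars \<open>K\<^bsub>1,k\<^esub>\<close>, for \<open>a = b = 1\<close> also \<open>K\<^sub>3\<close> and \<open>K\<^sub>4\<close>,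
  and for \<open>a = 1\<close>, \<open>b = 0\<close> also \<open>C\<^sub>4\<close> (\<open>extremal_decomposition\<close>). Finally a \<open>K\<^sub>4\<close> or \<open>C\<^sub>4\<close> has the edges of
  two stars, but coloured in one colour it does not contain two disjoint stars \<open>K\<^bsub>1,2\<^esub>\<close>
  (\<open>colouring_with_four_vertex_piece\<close>). This excludes \<open>K\<^sub>4\<close>, and \<open>C\<^sub>4\<close> for \<open>s \<ge> 2\<close>.
\<close>

section \<open>Edge sets, neighbourhoods and deletion of vertices\<close>

text \<open>Graphs without isolated vertices are determined by their edges, so a finite set of two-element
  sets stands for such a graph.\<close>

definition edge_set :: "'a set set \<Rightarrow> bool" where
  "edge_set E \<longleftrightarrow> finite E \<and> (\<forall>e\<in>E. card e = 2)"

text \<open>The neighbourhood of a vertex.\<close>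

definition nbrs :: "'a set set \<Rightarrow> 'a \<Rightarrow> 'a set" where
  "nbrs E v = {u. {v, u} \<in> E}"

text \<open>The edges that remain after the deletion of the vertices in \<open>U\<close>.\<close>

definition del :: "'a set \<Rightarrow> 'a set set \<Rightarrow> 'a set set" where
  "del U E = {e \<in> E. e \<inter> U = {}}"

lemma edge_set_subset: "edge_set E \<Longrightarrow> F \<subseteq> E \<Longrightarrow> edge_set F"
  unfolding edge_set_def by (auto intro: finite_subset)

lemma edge_set_del: "edge_set E \<Longrightarrow> edge_set (del U E)"
  by (rule edge_set_subset) (auto simp: del_def)

lemma edge_setE:
  assumes "edge_set E" "e \<in> E"
  obtains x y where "e = {x, y}" "x \<noteq> y"
  using assms unfolding edge_set_def by (metis card_2_iff)

lemma finite_Union_edge_set: "edge_set E \<Longrightarrow> finite (\<Union>E)"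
  unfolding edge_set_def by (metis card.infinite finite_Union zero_neq_numeral)

lemma nbrs_subset_Union: "nbrs E v \<subseteq> \<Union>E"
  unfolding nbrs_def by auto

lemma finite_nbrs: "edge_set E \<Longrightarrow> finite (nbrs E v)"
  using finite_Union_edge_set nbrs_subset_Union finite_subset by metis

lemma self_notin_nbrs: "edge_set E \<Longrightarrow> v \<notin> nbrs E v"
  unfolding edge_set_def nbrs_def by auto

lemma nbrs_commute: "u \<in> nbrs E v \<longleftrightarrow> v \<in> nbrs E u"
  unfolding nbrs_def by (simp add: insert_commute)

lemma nbrs_mono: "F \<subseteq> E \<Longrightarrow> nbrs F v \<subseteq> nbrs E v"
  unfolding nbrs_def by auto

lemma card_nbrs_mono: "edge_set E \<Longrightarrow> F \<subseteq> E \<Longrightarrow> card (nbrs F v) \<le> card (nbrs E v)"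
  by (simp add: card_mono finite_nbrs nbrs_mono)

lemma nbrs_Un: "nbrs (E \<union> F) v = nbrs E v \<union> nbrs F v"
  unfolding nbrs_def by auto

lemma card_nbrs_split:
  assumes "edge_set E" "R \<subseteq> E"
  shows "card (nbrs E v) = card (nbrs R v) + card (nbrs (E - R) v)"
proof -
  have "nbrs E v = nbrs R v \<union> nbrs (E - R) v" "nbrs R v \<inter> nbrs (E - R) v = {}"
    using assms(2) unfolding nbrs_def by auto
  then show ?thesis
    using assms finite_nbrs[OF edge_set_subset] by (metis Diff_subset card_Un_disjoint)
qed

lemma nbrs_del: "nbrs (del U E) v = (if v \<in> U then {} else nbrs E v - U)"
  unfolding nbrs_def del_def by auto

lemma del_del: "del U (del V E) = del (U \<union> V) E"
  unfolding del_def by auto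

lemma del_empty [simp]: "del {} E = E"
  unfolding del_def by auto

lemma del_subset: "del U E \<subseteq> E"
  unfolding del_def by auto

lemma card_incident: 
  assumes "edge_set E"
  shows "card {e\<in>E. v \<in> e} = card (nbrs E v)"
proof -
  have "{e\<in>E. v \<in> e} = (\<lambda>u. {v, u}) ` nbrs E v"
  proof (intro equalityI subsetI)
    fix e assume "e \<in> {e\<in>E. v \<in> e}"
    then have e: "e \<in> E" "v \<in> e" by auto
    obtain x y where "e = {x, y}" "x \<noteq> y" using edge_setE[OF assms e(1)] by blast
    with e(2) obtain u where "e = {v, u}" by blast
    with e(1) show "e \<in> (\<lambda>u. {v, u}) ` nbrs E v" unfolding nbrs_def by auto
  qed (auto simp: nbrs_def)
  moreover have "inj_on (\<lambda>u. {v, u}) (nbrs E v)"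
    by (auto simp: inj_on_def doubleton_eq_iff)
  ultimately show ?thesis by (simp add: card_image)
qed

lemma card_del_vertex:
  assumes "edge_set E"
  shows "card E = card (del {v} E) + card (nbrs E v)"
proof -
  have "E = del {v} E \<union> {e\<in>E. v \<in> e}" "del {v} E \<inter> {e\<in>E. v \<in> e} = {}"
    unfolding del_def by auto
  moreover have "finite E" using assms unfolding edge_set_def by auto
  ultimately show ?thesis
    by (metis card_Un_disjoint card_incident[OF assms] finite_Un)
qed

lemma weighted_handshake:
  fixes f :: "'a \<Rightarrow> nat"
  assumes "edge_set E" "finite V" "\<Union>E \<subseteq> V"
  shows "(\<Sum>v\<in>V. f v * card (nbrs E v)) = (\<Sum>e\<in>E. \<Sum>v\<in>e. f v)"
proof -
  have fE: "finite E" using assms unfolding edge_set_def by auto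
  have "(\<Sum>e\<in>E. \<Sum>v\<in>e. f v) = (\<Sum>e\<in>E. \<Sum>v\<in>V. if v \<in> e then f v else 0)"
  proof (rule sum.cong)
    fix e assume "e \<in> E"
    then have "V \<inter> {v. v \<in> e} = e" using assms(3) by auto
    then show "sum f e = (\<Sum>v\<in>V. if v \<in> e then f v else 0)"
      using assms(2) by (simp add: sum.If_cases)
  qed simp
  also have "\<dots> = (\<Sum>v\<in>V. \<Sum>e\<in>E. if v \<in> e then f v else 0)"
    by (rule sum.swap)
  also have "\<dots> = (\<Sum>v\<in>V. f v * card (nbrs E v))"
  proof (rule sum.cong)
    fix v
    have "E \<inter> {e. v \<in> e} = {e\<in>E. v \<in> e}" by auto
    then show "(\<Sum>e\<in>E. if v \<in> e then f v else 0) = f v * card (nbrs E v)"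
      using fE by (simp add: sum.If_cases card_incident[OF assms(1)] mult.commute)
  qed simp
  finally show ?thesis by simp
qed

section \<open>Splittings into two colours of bounded degree\<close>

text \<open>\<open>R\<close> is the set of red edges, and all other edges of \<open>E\<close> are blue; the red degrees are at most
  \<open>a\<close> and the blue ones at most \<open>b\<close>.\<close>

definition good_split :: "nat \<Rightarrow> nat \<Rightarrow> 'a set set \<Rightarrow> 'a set set \<Rightarrow> bool" where
  "good_split a b E R \<longleftrightarrow> R \<subseteq> E \<and> (\<forall>v. card (nbrs R v) \<le> a \<and> card (nbrs (E - R) v) \<le> b)"

text \<open>The edge set has such a colouring.\<close>

definition splits :: "nat \<Rightarrow> nat \<Rightarrow> 'a set set \<Rightarrow> bool" where
  "splits a b E \<longleftrightarrow> (\<exists>R. good_split a b E R)"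

text \<open>The deletion of fewer than \<open>N\<close> vertices never leaves an edge set that splits.\<close>

definition robust :: "nat \<Rightarrow> nat \<Rightarrow> nat \<Rightarrow> 'a set set \<Rightarrow> bool" where
  "robust a b N E \<longleftrightarrow> (\<forall>U. finite U \<and> card U < N \<longrightarrow> \<not> splits a b (del U E))"

text \<open>A splitting of \<open>F - x\<close> extends to \<open>x\<close> when few neighbours of \<open>x\<close> lack room for a blue edge, few
  lack room for a red one, and none lacks room for both: the edges from \<open>x\<close> to the former are
  coloured red, those to the latter blue, and the remaining edges serve to balance the two
  degrees of \<open>x\<close>.\<close>

lemma splits_extend_vertex:
  assumes F: "edge_set F" and R: "good_split a b (del {x} F) R"
    and dx: "card (nbrs F x) \<le> a + b"
    and nf: "\<And>u. u \<in> nbrs F x \<Longrightarrow> card (nbrs R u) = a \<Longrightarrow> card (nbrs (del {x} F - R) u) = b \<Longrightarrow> False"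
    and PR: "card {u \<in> nbrs F x. card (nbrs (del {x} F - R) u) = b} \<le> a"
    and PB: "card {u \<in> nbrs F x. card (nbrs R u) = a} \<le> b"
  shows "splits a b F"
proof -
  let ?N = "nbrs F x" and ?D = "del {x} F"
  let ?PR = "{u \<in> ?N. card (nbrs (?D - R) u) = b}"
  let ?PB = "{u \<in> ?N. card (nbrs R u) = a}"
  have fN: "finite ?N" using F by (rule finite_nbrs)
  have RD: "R \<subseteq> ?D" and Ra: "\<And>v. card (nbrs R v) \<le> a" and Bb: "\<And>v. card (nbrs (?D - R) v) \<le> b"
    using R unfolding good_split_def by auto
  have eR: "edge_set R" "edge_set (?D - R)" 
    using F RD del_subset[of "{x}" F] by (auto intro: edge_set_subset)
  have sub: "?PR \<subseteq> ?N - ?PB" using nf by auto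
  obtain S where S: "?PR \<subseteq> S" "S \<subseteq> ?N - ?PB" "card S = min a (card (?N - ?PB))"
    using exists_subset_between[of ?PR "min a (card (?N - ?PB))" "?N - ?PB"] PR sub fN
    by (smt (verit) card_mono finite_Diff min.boundedI min.cobounded2)
  have fS: "finite S" using S fN finite_subset by blast
  have cS: "card S \<le> a" using S by simp
  have cNS: "card (?N - S) \<le> b"
  proof (cases "a \<le> card (?N - ?PB)")
    case True
    then have "card S = a" using S by simp
    moreover have "card (?N - S) = card ?N - card S"
      using S fN fS by (intro card_Diff_subset) auto
    ultimately show ?thesis using dx by simp
  next
    case False
    then have "card S = card (?N - ?PB)" using S by simp
    then have "S = ?N - ?PB" using S fN by (simp add: card_subset_eq)
    then have "?N - S = ?PB" by auto
    then show ?thesis using PB by simp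
  qed
  define R' where "R' = R \<union> (\<lambda>u. {x, u}) ` S"
  have RnX: "{x, u} \<notin> R" "{x, u} \<notin> ?D" for u using RD unfolding del_def by auto
  have n1: "nbrs R' x = S"
    using RnX unfolding R'_def nbrs_def by (auto simp: doubleton_eq_iff)
  have n2: "nbrs (F - R') x = ?N - S"
    using RnX unfolding R'_def nbrs_def by (auto simp: doubleton_eq_iff)
  have n3: "nbrs R' u = nbrs R u \<union> (if u \<in> S then {x} else {})" if "u \<noteq> x" for u
    using that unfolding R'_def nbrs_def by (auto simp: doubleton_eq_iff)
  have n4: "nbrs (F - R') u = nbrs (?D - R) u \<union> (if u \<in> ?N - S then {x} else {})" if "u \<noteq> x" for u
    using that RnX unfolding R'_def nbrs_def del_def by (auto simp: doubleton_eq_iff insert_commute)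
  have "card (nbrs R' v) \<le> a \<and> card (nbrs (F - R') v) \<le> b" for v
  proof (cases "v = x")
    case True
    then show ?thesis using n1 n2 cS cNS by simp
  next
    case False
    have "card (nbrs R' v) \<le> a"
    proof (cases "v \<in> S")
      case True
      then have "card (nbrs R v) \<noteq> a" using S by auto
      then have "card (nbrs R v) < a" using Ra[of v] by simp
      then show ?thesis using n3[OF False] card_insert_if[OF finite_nbrs[OF eR(1)]] True by auto
    qed (use n3[OF False] Ra in auto)
    moreover have "card (nbrs (F - R') v) \<le> b"
    proof (cases "v \<in> ?N - S")
      case True
      then have "card (nbrs (?D - R) v) \<noteq> b" using S by auto
      then have "card (nbrs (?D - R) v) < b" using Bb[of v] by simp
      then show ?thesis using n4[OF False] card_insert_if[OF finite_nbrs[OF eR(2)]] True by auto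
    next
      case False2: False
      then have "nbrs (F - R') v = nbrs (?D - R) v" by (simp only: n4[OF False] if_not_P[OF False2] if_False False2 Un_empty_right)
      then show ?thesis using Bb by simp
    qed
    ultimately show ?thesis by simp
  qed
  moreover have "R' \<subseteq> F" using RD S(2) unfolding R'_def del_def nbrs_def by auto
  ultimately show ?thesis unfolding splits_def good_split_def by blast
qed

lemma good_split_swap: "good_split a b E R \<Longrightarrow> good_split b a E (E - R)"
  unfolding good_split_def by (auto simp: double_diff)

lemma nbrs_insert_edge:
  "nbrs (insert {w, w'} R) u =
     nbrs R u \<union> (if u = w then {w'} else {}) \<union> (if u = w' then {w} else {})"
  unfolding nbrs_def by (auto simp: doubleton_eq_iff)

lemma nbrs_remove_edge:
  "nbrs (R - {{w, w'}}) u =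
     nbrs R u - (if u = w then {w'} else {}) - (if u = w' then {w} else {})"
  unfolding nbrs_def by (auto simp: doubleton_eq_iff)

text \<open>The vertices that can still take one more edge of either colour.\<close>

definition flexible :: "nat \<Rightarrow> nat \<Rightarrow> 'a set set \<Rightarrow> 'a set set \<Rightarrow> 'a set" where
  "flexible a b E R = {w \<in> \<Union>E. card (nbrs R w) < a \<and> card (nbrs (E - R) w) < b}"

lemma flexible_swap: "R \<subseteq> E \<Longrightarrow> flexible b a E (E - R) = flexible a b E R"
  unfolding flexible_def by (auto simp: double_diff)

text \<open>Recolouring a blue edge between two blue-saturated vertices keeps the splitting good if both
  ends have room for a red edge; if \<open>w\<close> has room for a second one, it becomes flexible.\<close>

lemma recolour_edge:
  assumes E: "edge_set E" and R: "good_split a b E R" and e: "{w, w'} \<in> E - R"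
    and fw: "card (nbrs (E - R) w) = b" and fw': "card (nbrs (E - R) w') = b"
    and rw: "card (nbrs R w) + 1 < a" and rw': "card (nbrs R w') < a"
  shows "good_split a b E (insert {w, w'} R)"
    and "card (flexible a b E R) < card (flexible a b E (insert {w, w'} R))"
proof -
  let ?R = "insert {w, w'} R"
  have ne: "w \<noteq> w'" using E e unfolding edge_set_def by auto
  have RE: "R \<subseteq> E" and Ra: "\<And>v. card (nbrs R v) \<le> a" and Bb: "\<And>v. card (nbrs (E - R) v) \<le> b"
    using R unfolding good_split_def by auto
  have eR: "edge_set R" "edge_set (E - R)" using E RE by (auto intro: edge_set_subset)
  have B: "E - ?R = (E - R) - {{w, w'}}" by auto
  have mem: "w' \<in> nbrs (E - R) w" "w \<in> nbrs (E - R) w'" using e by (auto simp: nbrs_def insert_commute)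
  have fin: "finite (nbrs R v)" "finite (nbrs (E - R) v)" for v
    using finite_nbrs[OF eR(1)] finite_nbrs[OF eR(2)] by auto
  have b1: "0 < b" using mem(1) fin(2)[of w] fw by (auto simp: card_gt_0_iff)
  have r1: "card (nbrs ?R v) \<le> card (nbrs R v) + (if v \<in> {w, w'} then 1 else 0)" for v
    using ne fin(1)[of v] by (auto simp: nbrs_insert_edge card_insert_if)
  have b2: "card (nbrs (E - ?R) v) \<le> card (nbrs (E - R) v)" for v
    using eR(2) unfolding B by (intro card_nbrs_mono) auto
  have b3: "card (nbrs (E - ?R) v) < b" if "v \<in> {w, w'}" for v
  proof -
    have "nbrs (E - ?R) v \<subset> nbrs (E - R) v"
      using that mem ne unfolding B nbrs_remove_edge by auto
    then have "card (nbrs (E - ?R) v) < card (nbrs (E - R) v)" by (rule psubset_card_mono[OF fin(2)])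
    then show ?thesis using that fw fw' by auto
  qed
  show "good_split a b E ?R"
    unfolding good_split_def
  proof (intro conjI allI)
    show "?R \<subseteq> E" using RE e by auto
    fix v
    show "card (nbrs ?R v) \<le> a" using r1[of v] Ra[of v] rw rw' by (cases "v = w"; cases "v = w'") auto
    show "card (nbrs (E - ?R) v) \<le> b" using b2[of v] Bb[of v] by simp
  qed
  have "flexible a b E R \<subset> flexible a b E ?R"
  proof
    show "flexible a b E R \<subseteq> flexible a b E ?R"
    proof
      fix v assume v: "v \<in> flexible a b E R"
      then have "v \<notin> {w, w'}" using fw fw' unfolding flexible_def by auto
      then have "card (nbrs ?R v) \<le> card (nbrs R v)" using r1[of v] by simp
      then show "v \<in> flexible a b E ?R" using v b2[of v] unfolding flexible_def by simp
    qed
    have "w \<in> flexible a b E ?R" using e r1[of w] rw b3[of w] unfolding flexible_def by auto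
    moreover have "w \<notin> flexible a b E R" using fw unfolding flexible_def by auto
    ultimately show "flexible a b E R \<noteq> flexible a b E ?R" by auto
  qed
  moreover have "finite (flexible a b E ?R)"
    using finite_Union_edge_set[OF E] unfolding flexible_def by (rule rev_finite_subset) auto
  ultimately show "card (flexible a b E R) < card (flexible a b E ?R)" by (rule psubset_card_mono[rotated])
qed

text \<open>A good splitting in which no recolouring of a single edge between two vertices saturated in
  its colour makes one of them flexible.\<close>

definition balanced_split :: "nat \<Rightarrow> nat \<Rightarrow> 'a set set \<Rightarrow> 'a set set \<Rightarrow> bool" where
  "balanced_split a b E R \<longleftrightarrow> good_split a b E R \<and>
     (\<forall>w w'. {w, w'} \<in> E - R \<and> card (nbrs (E - R) w) = b \<and> card (nbrs (E - R) w') = b \<and>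
        card (nbrs R w') < a \<longrightarrow> a \<le> card (nbrs R w) + 1) \<and>
     (\<forall>w w'. {w, w'} \<in> R \<and> card (nbrs R w) = a \<and> card (nbrs R w') = a \<and>
        card (nbrs (E - R) w') < b \<longrightarrow> b \<le> card (nbrs (E - R) w) + 1)"

lemma ex_balanced_split:
  assumes E: "edge_set E" and s: "splits a b E"
  shows "\<exists>R. balanced_split a b E R"
proof -
  obtain R0 where "good_split a b E R0" using s unfolding splits_def by auto
  moreover have "card (flexible a b E R) \<le> card (\<Union>E)" for R
    by (rule card_mono[OF finite_Union_edge_set[OF E]]) (auto simp: flexible_def)
  ultimately have "\<exists>R. good_split a b E R \<and>
      (\<forall>R'. good_split a b E R' \<longrightarrow> card (flexible a b E R') \<le> card (flexible a b E R))"
    by (intro ex_has_greatest_nat[of "good_split a b E" R0 "\<lambda>R. card (flexible a b E R)" "Suc (card (\<Union>E))"])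
      (auto simp: less_Suc_eq_le)
  then obtain R where R: "good_split a b E R"
    and mx: "\<And>R'. good_split a b E R' \<Longrightarrow> card (flexible a b E R') \<le> card (flexible a b E R)"
    by blast
  have RE: "R \<subseteq> E" using R unfolding good_split_def by auto
  have BB: "E - (E - R) = R" using RE by auto
  have "a \<le> card (nbrs R w) + 1"
    if h: "{w, w'} \<in> E - R" "card (nbrs (E - R) w) = b" "card (nbrs (E - R) w') = b" "card (nbrs R w') < a" for w w'
  proof (rule ccontr)
    assume "\<not> ?thesis"
    then have "card (nbrs R w) + 1 < a" by simp
    from recolour_edge[OF E R h(1-3) this h(4)] mx[of "insert {w, w'} R"] show False by simp
  qed
  moreover have "b \<le> card (nbrs (E - R) w) + 1"
    if h: "{w, w'} \<in> R" "card (nbrs R w) = a" "card (nbrs R w') = a" "card (nbrs (E - R) w') < b" for w w'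
  proof (rule ccontr)
    assume "\<not> ?thesis"
    then have c: "card (nbrs (E - R) w) + 1 < b" by simp
    let ?R = "insert {w, w'} (E - R)"
    have e: "{w, w'} \<in> E - (E - R)" using h(1) BB by simp
    have "good_split b a E ?R" "card (flexible b a E (E - R)) < card (flexible b a E ?R)"
      using recolour_edge[OF E good_split_swap[OF R] e _ _ c h(4)] h(2,3) unfolding BB by auto
    moreover have R2: "?R \<subseteq> E" using RE h(1) by auto
    ultimately show False
      using mx[OF good_split_swap, of ?R] flexible_swap[OF RE, of b a] flexible_swap[OF R2, of a b] by simp
  qed
  ultimately show ?thesis using R unfolding balanced_split_def by blast
qed

section \<open>Counting edges around a smallest deletion set\<close>

text \<open>Here \<open>W\<close> consists of vertices with \<open>b\<close> edges of one colour (the edges in \<open>B\<close>), \<open>r w\<close> is the degree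
  of \<open>w\<close> in the other colour and \<open>j w\<close> the number of its deleted neighbours. An edge of \<open>B\<close> has both ends
  in \<open>W\<close> only if \<open>r w = a - 1\<close> at both ends, so a vertex with \<open>r w < a - 1\<close> may claim its edges
  entirely, and the others half of each.\<close>

lemma saturated_credit:
  fixes r j :: "'a \<Rightarrow> nat"
  assumes B: "edge_set B" and fW: "finite W"
    and W: "\<And>w. w \<in> W \<Longrightarrow> card (nbrs B w) = b \<and> r w < a \<and> r w + j w \<le> a"
    and adj: "\<And>w w'. {w, w'} \<in> B \<Longrightarrow> w \<in> W \<Longrightarrow> w' \<in> W \<Longrightarrow> a \<le> r w + 1"
  shows "b * (\<Sum>w\<in>W. j w) \<le> max 2 a * card B"
proof -
  define wt :: "'a \<Rightarrow> nat" where "wt w = (if w \<in> W then if a \<le> r w + 1 then 1 else 2 else 0)" for w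
  have "2 * j w \<le> max 2 a * wt w" if "w \<in> W" for w
  proof (cases "a \<le> r w + 1")
    case True
    then have "j w \<le> 1" "wt w = 1" using W[OF that] that unfolding wt_def by auto
    then show ?thesis by simp
  next
    case False
    then have "j w \<le> a" "wt w = 2" using W[OF that] that unfolding wt_def by auto
    then show ?thesis by simp
  qed
  then have "(\<Sum>w\<in>W. 2 * j w) \<le> (\<Sum>w\<in>W. max 2 a * wt w)" by (rule sum_mono)
  then have 1: "2 * (\<Sum>w\<in>W. j w) \<le> max 2 a * (\<Sum>w\<in>W. wt w)" by (simp add: sum_distrib_left)
  let ?V = "\<Union>B \<union> W"
  have fV: "finite ?V" using finite_Union_edge_set[OF B] fW by auto
  have "b * (\<Sum>w\<in>W. wt w) = (\<Sum>w\<in>W. wt w * card (nbrs B w))"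
    unfolding sum_distrib_left
  proof (rule sum.cong)
    fix w assume "w \<in> W"
    then show "b * wt w = wt w * card (nbrs B w)" using W[of w] by simp
  qed simp
  also have "\<dots> \<le> (\<Sum>w\<in>?V. wt w * card (nbrs B w))"
    using fV by (intro sum_mono2) auto
  also have "\<dots> = (\<Sum>e\<in>B. \<Sum>v\<in>e. wt v)" using fV by (intro weighted_handshake[OF B]) auto
  also have "\<dots> \<le> (\<Sum>e\<in>B. 2)"
  proof (rule sum_mono)
    fix e assume eB: "e \<in> B"
    obtain x y where e: "e = {x, y}" "x \<noteq> y" using edge_setE[OF B eB] by blast
    have "{y, x} = {x, y}" by auto
    then have "wt x + wt y \<le> 2"
      using adj[of x y] adj[of y x] eB e(1) unfolding wt_def by auto
    then show "(\<Sum>v\<in>e. wt v) \<le> 2" using e by simp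
  qed
  finally have 2: "b * (\<Sum>w\<in>W. wt w) \<le> 2 * card B" by simp
  have "2 * (b * (\<Sum>w\<in>W. j w)) \<le> max 2 a * (b * (\<Sum>w\<in>W. wt w))"
    using mult_le_mono2[OF 1, of b] by (simp only: mult.left_commute)
  also have "\<dots> \<le> max 2 a * (2 * card B)" using 2 by (rule mult_le_mono2)
  finally show ?thesis by simp
qed

lemma sum_card_nbrs_swap:
  assumes "finite A" "finite U"
  shows "(\<Sum>w\<in>A. card (nbrs E w \<inter> U)) = (\<Sum>x\<in>U. card (nbrs E x \<inter> A))"
proof -
  have 1: "nbrs E w \<inter> U = {x \<in> U. w \<in> nbrs E x}" "nbrs E x \<inter> A = {w \<in> A. w \<in> nbrs E x}" for w x
    by (auto simp: nbrs_commute[of _ E w])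
  show ?thesis unfolding 1
    by (rule sum_multicount_gen[of U A "\<lambda>x w. w \<in> nbrs E x", symmetric]) (use assms in auto)
qed

lemma card_edges_ge:
  assumes E: "edge_set E" and U: "finite U" and W: "finite W" "W \<inter> U = {}"
  shows "card (del U E) + (\<Sum>x\<in>U. card (nbrs E x \<inter> W)) \<le> card E"
proof -
  have fE: "finite E" using E unfolding edge_set_def by auto
  let ?S = "SIGMA x:U. nbrs E x \<inter> W" and ?f = "\<lambda>(x, w). {x, w}"
  have "inj_on ?f ?S" using W(2) by (auto simp: inj_on_def doubleton_eq_iff)
  then have "card (?f ` ?S) = card ?S" by (rule card_image)
  also have "\<dots> = (\<Sum>x\<in>U. card (nbrs E x \<inter> W))" using U W by (simp add: card_SigmaI)
  finally have 1: "card (?f ` ?S) = (\<Sum>x\<in>U. card (nbrs E x \<inter> W))" .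
  have 2: "?f ` ?S \<subseteq> E" by (auto simp: nbrs_def)
  have 3: "del U E \<inter> ?f ` ?S = {}" by (auto simp: del_def)
  have "card (del U E \<union> ?f ` ?S) \<le> card E"
    using 2 del_subset[of U E] fE by (intro card_mono) auto
  then show ?thesis
    using 1 3 2 fE finite_subset[OF del_subset fE] finite_subset[OF 2 fE] by (simp add: card_Un_disjoint)
qed

text \<open>Minimality of the deletion set: no deleted vertex \<open>x\<close> can be put back into a good splitting.\<close>

lemma saturated_nbrs:
  assumes E: "edge_set E" and U: "finite U" and x: "x \<in> U"
    and mini: "\<And>U'. finite U' \<Longrightarrow> card U' < card U \<Longrightarrow> \<not> splits a b (del U' E)"
    and deg: "\<And>v. card (nbrs E v) \<le> a + b"
    and R: "good_split a b (del U E) R"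
  shows "a < card {u \<in> nbrs E x - U. card (nbrs (del U E - R) u) = b} \<or>
         b < card {u \<in> nbrs E x - U. card (nbrs R u) = a}"
proof (rule ccontr)
  assume c: "\<not> ?thesis"
  let ?F = "del (U - {x}) E"
  have F: "edge_set ?F" by (rule edge_set_del[OF E])
  have d: "del {x} ?F = del U E" using x unfolding del_del by (simp add: insert_absorb)
  have n: "nbrs ?F x = nbrs E x - U" using self_notin_nbrs[OF E, of x] x unfolding nbrs_del by auto
  have R': "good_split a b (del {x} ?F) R" using R d by simp
  have RF: "R \<subseteq> del U E" using R unfolding good_split_def by auto
  have "splits a b ?F"
  proof (rule splits_extend_vertex[OF F R'])
    show "card (nbrs ?F x) \<le> a + b"
      using card_nbrs_mono[OF E del_subset[of "U - {x}"], of x] deg[of x] by simp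
    fix u assume u: "u \<in> nbrs ?F x" "card (nbrs R u) = a" "card (nbrs (del {x} ?F - R) u) = b"
    have uU: "u \<notin> U" and xu: "x \<in> nbrs E u" using u(1) n nbrs_commute[of x E u] by auto
    have "a + b = card (nbrs (del U E) u)"
      using u card_nbrs_split[OF edge_set_del[OF E] RF] d by simp
    also have "\<dots> < card (nbrs E u)"
      using x xu uU finite_nbrs[OF E] unfolding nbrs_del by (intro psubset_card_mono) auto
    finally show False using deg[of u] by simp
  qed (use c n d in auto)
  moreover have "card (U - {x}) < card U" using U x by (rule card_Diff1_less)
  ultimately show False using mini[of "U - {x}"] U by auto
qed

text \<open>The weight of a deleted vertex with \<open>p\<close> blue-saturated and \<open>q\<close> red-saturated neighbours: one for
  each edge to them, and the share of the edges credited to them.\<close>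

lemma vertex_weight:
  fixes p q a b :: nat
  assumes b: "1 \<le> b" "b \<le> a" and pq: "a < p \<or> b < q"
  defines "T \<equiv> real p * (1 + real b / real (max 2 a)) + real q * (1 + real a / real (max 2 b))"
  shows "real (a + b + 1) \<le> T"
    and "T = real (a + b + 1) \<Longrightarrow> b = 1 \<and> (a = 1 \<and> p + q = 2 \<or> 2 \<le> a \<and> p = 0 \<and> q = 2)"
proof -
  have "real (a + b + 1) \<le> T \<and>
      (T = real (a + b + 1) \<longrightarrow> b = 1 \<and> (a = 1 \<and> p + q = 2 \<or> 2 \<le> a \<and> p = 0 \<and> q = 2))"
  proof (cases "a = 1")
    case True
    then have "b = 1" "2 \<le> p + q" using b pq by auto
    then have "T = 3 / 2 * real (p + q)" using True unfolding T_def by (simp add: algebra_simps)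
    then show ?thesis using True \<open>b = 1\<close> \<open>2 \<le> p + q\<close> by auto
  next
    case False
    then have a2: "2 \<le> a" using b by simp
    have P: "0 \<le> real p * (1 + real b / real (max 2 a))" and Q: "0 \<le> real q * (1 + real a / real (max 2 b))"
      by auto
    show ?thesis
    proof (cases "a < p")
      case True
      have "real (a + b + 1) < real (a + 1) * (1 + real b / real a)"
        using a2 b by (simp add: field_simps)
      also have "\<dots> \<le> real p * (1 + real b / real a)" using True by (intro mult_right_mono) auto
      also have "\<dots> \<le> T" using a2 Q unfolding T_def by (simp add: max_def)
      finally show ?thesis by simp
    next
      case F: False
      then have q: "b + 1 \<le> q" using pq by simp
      show ?thesis
      proof (cases "b = 1")
        case True
        have qT: "real (a + b + 1) \<le> real q * (1 + real a / 2)"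
        proof -
          have "2 * (1 + real a / 2) \<le> real q * (1 + real a / 2)" using q True by (intro mult_right_mono) auto
          then show ?thesis using True by simp
        qed
        have T: "T = real p * (1 + 1 / real a) + real q * (1 + real a / 2)"
          using True a2 unfolding T_def by (simp add: max_def)
        have "0 \<le> real p * (1 + 1 / real a)" by simp
        then have le: "real (a + b + 1) \<le> T" using T qT by linarith
        have "p = 0 \<and> q = 2" if "T = real (a + b + 1)"
        proof -
          have "p = 0"
          proof (rule ccontr)
            assume "p \<noteq> 0"
            then have "0 < real p * (1 + 1 / real a)" by (intro mult_pos_pos add_pos_nonneg) auto
            then show False using that T qT by linarith
          qed
          from \<open>p = 0\<close> have "real q * (1 + real a / 2) = 2 * (1 + real a / 2)" using that T True by simp
          moreover have "1 + real a / 2 \<noteq> 0" using a2 by linarith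
          ultimately have "real q = 2" by (metis mult_right_cancel)
          with \<open>p = 0\<close> show ?thesis by simp
        qed
        with le show ?thesis using True a2 by blast
      next
        case False
        then have b2: "2 \<le> b" using b by simp
        have "real (a + b + 1) < real (b + 1) * (1 + real a / real b)"
          using b2 a2 by (simp add: field_simps)
        also have "\<dots> \<le> real q * (1 + real a / real b)" using q by (intro mult_right_mono) auto
        also have "\<dots> \<le> T" using b2 P unfolding T_def by (simp add: max_def)
        finally show ?thesis by simp
      qed
    qed
  qed
  then show "real (a + b + 1) \<le> T"
    and "T = real (a + b + 1) \<Longrightarrow> b = 1 \<and> (a = 1 \<and> p + q = 2 \<or> 2 \<le> a \<and> p = 0 \<and> q = 2)"
    by auto
qed

lemma counting_inequalities:
  assumes E: "edge_set E" and U: "finite U"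
    and deg: "\<And>v. card (nbrs E v) \<le> a + b"
    and R: "balanced_split a b (del U E) R"
  shows "b * (\<Sum>x\<in>U. card {u \<in> nbrs E x - U. card (nbrs (del U E - R) u) = b}) \<le> max 2 a * card (del U E - R)"
    and "a * (\<Sum>x\<in>U. card {u \<in> nbrs E x - U. card (nbrs R u) = a}) \<le> max 2 b * card R"
    and "card R + card (del U E - R) + (\<Sum>x\<in>U. card (nbrs E x - U)) \<le> card E"
    and "x \<in> U \<Longrightarrow>
         card {u \<in> nbrs E x - U. card (nbrs (del U E - R) u) = b} + card {u \<in> nbrs E x - U. card (nbrs R u) = a}
           \<le> card (nbrs E x - U)"
proof -
  let ?F = "del U E" and ?B = "del U E - R" and ?W = "\<Union>E - U"
  have F: "edge_set ?F" by (rule edge_set_del[OF E])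
  have fW: "finite ?W" using finite_Union_edge_set[OF E] by simp
  have g: "good_split a b ?F R" using R unfolding balanced_split_def by auto
  have RF: "R \<subseteq> ?F" using g unfolding good_split_def by auto
  have eR: "edge_set R" "edge_set ?B" using F RF by (auto intro: edge_set_subset)
  have total: "card (nbrs R w) + card (nbrs ?B w) + card (nbrs E w \<inter> U) \<le> a + b" if "w \<notin> U" for w
  proof -
    have "card (nbrs R w) + card (nbrs ?B w) = card (nbrs E w - U)"
      using card_nbrs_split[OF F RF, of w] that unfolding nbrs_del by simp
    moreover have "card (nbrs E w) = card (nbrs E w - U) + card (nbrs E w \<inter> U)"
      using finite_nbrs[OF E, of w] by (metis card_Int_Diff add.commute)
    ultimately show ?thesis using deg[of w] by simp
  qed
  have jpos: "0 < card (nbrs E w \<inter> U)" if "x \<in> U" "w \<in> nbrs E x" for x w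
    using that finite_nbrs[OF E, of w] by (auto simp: card_gt_0_iff nbrs_commute[of w E x])
  define WR where "WR = {w \<in> ?W. card (nbrs ?B w) = b \<and> card (nbrs R w) < a}"
  define WB where "WB = {w \<in> ?W. card (nbrs R w) = a \<and> card (nbrs ?B w) < b}"
  have fin: "finite WR" "finite WB"
    by (rule finite_subset[OF _ fW], auto simp: WR_def WB_def)+
  have PR: "{u \<in> nbrs E x - U. card (nbrs ?B u) = b} = nbrs E x \<inter> WR" if "x \<in> U" for x
  proof (intro equalityI subsetI)
    fix u assume "u \<in> {u \<in> nbrs E x - U. card (nbrs ?B u) = b}"
    then show "u \<in> nbrs E x \<inter> WR"
      using total[of u] jpos[OF that, of u] nbrs_subset_Union[of E x] unfolding WR_def by auto
  qed (auto simp: WR_def)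
  have PB: "{u \<in> nbrs E x - U. card (nbrs R u) = a} = nbrs E x \<inter> WB" if "x \<in> U" for x
  proof (intro equalityI subsetI)
    fix u assume "u \<in> {u \<in> nbrs E x - U. card (nbrs R u) = a}"
    then show "u \<in> nbrs E x \<inter> WB"
      using total[of u] jpos[OF that, of u] nbrs_subset_Union[of E x] unfolding WB_def by auto
  qed (auto simp: WB_def)
  have "b * (\<Sum>w\<in>WR. card (nbrs E w \<inter> U)) \<le> max 2 a * card ?B"
  proof (rule saturated_credit[OF eR(2) fin(1), where r = "\<lambda>w. card (nbrs R w)"])
    fix w assume "w \<in> WR"
    then show "card (nbrs ?B w) = b \<and> card (nbrs R w) < a \<and> card (nbrs R w) + card (nbrs E w \<inter> U) \<le> a"
      using total[of w] unfolding WR_def by auto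
  next
    fix w w' assume "{w, w'} \<in> ?B" "w \<in> WR" "w' \<in> WR"
    then show "a \<le> card (nbrs R w) + 1" using R unfolding balanced_split_def WR_def by blast
  qed
  then show "b * (\<Sum>x\<in>U. card {u \<in> nbrs E x - U. card (nbrs ?B u) = b}) \<le> max 2 a * card ?B"
    using PR by (simp add: sum_card_nbrs_swap[OF fin(1) U])
  have "a * (\<Sum>w\<in>WB. card (nbrs E w \<inter> U)) \<le> max 2 b * card R"
  proof (rule saturated_credit[OF eR(1) fin(2), where r = "\<lambda>w. card (nbrs ?B w)"])
    fix w assume "w \<in> WB"
    then show "card (nbrs R w) = a \<and> card (nbrs ?B w) < b \<and> card (nbrs ?B w) + card (nbrs E w \<inter> U) \<le> b"
      using total[of w] unfolding WB_def by auto
  next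
    fix w w' assume "{w, w'} \<in> R" "w \<in> WB" "w' \<in> WB"
    then show "b \<le> card (nbrs ?B w) + 1" using R unfolding balanced_split_def WB_def by blast
  qed
  then show "a * (\<Sum>x\<in>U. card {u \<in> nbrs E x - U. card (nbrs R u) = a}) \<le> max 2 b * card R"
    using PB by (simp add: sum_card_nbrs_swap[OF fin(2) U])
  have fF: "finite ?F" using F unfolding edge_set_def by auto
  have "card ?F = card R + card ?B"
    using RF fF by (simp add: card_Diff_subset finite_subset card_mono)
  moreover have "nbrs E x \<inter> ?W = nbrs E x - U" for x using nbrs_subset_Union[of E x] by auto
  ultimately show "card R + card ?B + (\<Sum>x\<in>U. card (nbrs E x - U)) \<le> card E"
    using card_edges_ge[OF E U fW] by (simp add: Diff_disjoint Int_commute)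
  show "card {u \<in> nbrs E x - U. card (nbrs ?B u) = b} + card {u \<in> nbrs E x - U. card (nbrs R u) = a}
           \<le> card (nbrs E x - U)" if "x \<in> U" for x
  proof -
    have "card (nbrs E x \<inter> WR) + card (nbrs E x \<inter> WB) = card (nbrs E x \<inter> WR \<union> nbrs E x \<inter> WB)"
      using fin by (intro card_Un_disjoint[symmetric]) (auto simp: WR_def WB_def)
    also have "\<dots> \<le> card (nbrs E x - U)"
      using finite_nbrs[OF E] by (intro card_mono) (auto simp: WR_def WB_def)
    finally show ?thesis unfolding PR[OF that] PB[OF that] .
  qed
qed

text \<open>A smallest deletion set \<open>U\<close> satisfies \<open>|E| \<ge> |U| (a + b + 1)\<close>. Equality for nonempty \<open>U\<close> is possible
  only if \<open>a = b = 1\<close>, and then each deleted vertex has two neighbours outside \<open>U\<close> and exactly \<open>|U|\<close>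
  edges avoid \<open>U\<close>.\<close>

lemma smallest_deletion_set:
  assumes E: "edge_set E" and U: "finite U" and ab: "1 \<le> b" "b \<le> a"
    and mini: "\<And>U'. finite U' \<Longrightarrow> card U' < card U \<Longrightarrow> \<not> splits a b (del U' E)"
    and spl: "splits a b (del U E)"
    and deg: "\<And>v. card (nbrs E v) \<le> a + b"
  shows "card U * (a + b + 1) \<le> card E"
    and "card E = card U * (a + b + 1) \<Longrightarrow> U \<noteq> {} \<Longrightarrow>
      a = 1 \<and> b = 1 \<and> card (del U E) = card U \<and> (\<forall>x\<in>U. card (nbrs E x - U) = 2)"
proof -
  let ?F = "del U E" 
  have F: "edge_set ?F" by (rule edge_set_del[OF E])
  obtain R where R: "balanced_split a b ?F R" using ex_balanced_split[OF F spl] by auto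
  let ?B = "?F - R"
  have g: "good_split a b ?F R" using R unfolding balanced_split_def by auto
  define p where "p x = card {u \<in> nbrs E x - U. card (nbrs ?B u) = b}" for x
  define q where "q x = card {u \<in> nbrs E x - U. card (nbrs R u) = a}" for x
  define s where "s x = card (nbrs E x - U)" for x
  define T where "T x = real (p x) * (1 + real b / real (max 2 a)) + real (q x) * (1 + real a / real (max 2 b))" for x
  have i1: "b * sum p U \<le> max 2 a * card ?B" and i2: "a * sum q U \<le> max 2 b * card R"
    and i3: "card R + card ?B + sum s U \<le> card E" and i4: "\<And>x. x \<in> U \<Longrightarrow> p x + q x \<le> s x"
    using counting_inequalities[OF E U deg R] unfolding p_def q_def s_def by auto
  have sat: "a < p x \<or> b < q x" if "x \<in> U" for x
    using saturated_nbrs[OF E U that mini deg g] unfolding p_def q_def by auto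
  have r1: "real b / real (max 2 a) * real (sum p U) \<le> real (card ?B)"
  proof -
    have "real b * real (sum p U) \<le> real (max 2 a) * real (card ?B)" using i1 by (metis of_nat_le_iff of_nat_mult)
    then show ?thesis by (simp add: field_simps)
  qed
  have r2: "real a / real (max 2 b) * real (sum q U) \<le> real (card R)"
  proof -
    have "real a * real (sum q U) \<le> real (max 2 b) * real (card R)" using i2 by (metis of_nat_le_iff of_nat_mult)
    then show ?thesis by (simp add: field_simps)
  qed
  have "sum p U + sum q U \<le> sum s U" using i4 by (simp add: sum_mono flip: sum.distrib)
  then have r3: "real (sum p U) + real (sum q U) \<le> real (sum s U)" by linarith
  have ST: "sum T U = real (sum p U) + real (sum q U) + real b / real (max 2 a) * real (sum p U)
      + real a / real (max 2 b) * real (sum q U)"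
    unfolding T_def by (simp add: sum.distrib sum_distrib_left sum_divide_distrib algebra_simps)
  have TE: "sum T U \<le> real (card R + card ?B) + real (sum s U)" using ST r1 r2 r3 by simp
  have Tk: "real (a + b + 1) \<le> T x" if "x \<in> U" for x
    using vertex_weight(1)[OF ab sat[OF that]] unfolding T_def by simp
  have kT: "real (card U) * real (a + b + 1) \<le> sum T U"
    using sum_mono[of U "\<lambda>_. real (a + b + 1)" T] Tk by simp
  have i3r: "real (card R + card ?B) + real (sum s U) \<le> real (card E)" using i3 by linarith
  have "real (card U * (a + b + 1)) \<le> real (card E)" using kT TE i3r by (simp only: of_nat_mult)
  then show "card U * (a + b + 1) \<le> card E" by (simp only: of_nat_le_iff)
  assume eq: "card E = card U * (a + b + 1)" and ne: "U \<noteq> {}"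
  then have "real (card E) = real (card U) * real (a + b + 1)" by (simp only: of_nat_mult)
  then have STeq: "sum T U = real (card U) * real (a + b + 1)"
    and REeq: "real (card R + card ?B) + real (sum s U) = sum T U" using kT TE i3r by linarith+
  have Teq: "T x = real (a + b + 1)" if "x \<in> U" for x
  proof (rule ccontr)
    assume "T x \<noteq> real (a + b + 1)"
    then have "real (a + b + 1) < T x" using Tk[OF that] by simp
    then have "sum (\<lambda>_. real (a + b + 1)) U < sum T U" using U Tk that by (intro sum_strict_mono_ex1) auto
    then show False using STeq by simp
  qed
  have cases: "b = 1 \<and> (a = 1 \<and> p x + q x = 2 \<or> 2 \<le> a \<and> p x = 0 \<and> q x = 2)" if "x \<in> U" for x
    using vertex_weight(2)[OF ab sat[OF that]] Teq[OF that] unfolding T_def by simp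
  have b1: "b = 1" using cases ne by auto
  have pq: "p x + q x = 2" if "x \<in> U" for x using cases[OF that] by auto
  have spq: "sum p U + sum q U = 2 * card U" using pq by (simp flip: sum.distrib)
  have s2: "2 \<le> s x" if "x \<in> U" for x using i4[OF that] pq[OF that] by simp
  have sums: "real (sum s U) = real (sum p U) + real (sum q U)"
    and cB: "real (card ?B) = real b / real (max 2 a) * real (sum p U)"
    and cR: "real (card R) = real a / real (max 2 b) * real (sum q U)"
    using REeq ST r1 r2 r3 by simp_all
  have sU: "sum s U = 2 * card U" using sums spq by linarith
  have seq: "s x = 2" if "x \<in> U" for x
  proof (rule ccontr)
    assume "s x \<noteq> 2"
    then have "sum (\<lambda>_. 2) U < sum s U" using U s2 that by (intro sum_strict_mono_ex1) (auto simp: le_less)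
    then show False using sU by simp
  qed
  have "a = 1"
  proof (rule ccontr)
    assume "a \<noteq> 1"
    then have a2: "2 \<le> a" and p0: "\<And>x. x \<in> U \<Longrightarrow> p x = 0" and q2: "\<And>x. x \<in> U \<Longrightarrow> q x = 2" 
      using cases ne by fastforce+
    \<comment> \<open>no edge is blue; recolouring one red edge at a neighbour of \<open>x\<close> lets \<open>x\<close> be put back\<close>
    have "card ?B = 0" using cB p0 by simp
    moreover have "finite ?B" using F unfolding edge_set_def by auto
    ultimately have B0: "?B = {}" by simp
    obtain x where x: "x \<in> U" using ne by auto
    have fN: "finite (nbrs E x - U)" using finite_nbrs[OF E] by simp
    have Nx: "{u \<in> nbrs E x - U. card (nbrs R u) = a} = nbrs E x - U"
      using q2[OF x] seq[OF x] fN unfolding q_def s_def by (intro card_subset_eq) auto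
    have "nbrs E x - U \<noteq> {}" using seq[OF x] unfolding s_def by (metis card.empty zero_neq_numeral)
    then obtain w where w: "w \<in> nbrs E x - U" by blast
    have "card (nbrs R w) = a" using w Nx by blast
    then have "nbrs R w \<noteq> {}" using a2 by auto
    then obtain z where z: "{w, z} \<in> R" unfolding nbrs_def by blast
    have RF: "R \<subseteq> ?F" and Ra: "\<And>v. card (nbrs R v) \<le> a" using g unfolding good_split_def by auto
    have RF': "R = ?F" using RF B0 by auto
    let ?R = "R - {{w, z}}"
    have B': "?F - ?R = {{w, z}}" using z RF' by auto
    have wz: "w \<noteq> z" using z RF F unfolding edge_set_def by fastforce
    have nb: "nbrs {{w, z}} v = (if v = w then {z} else if v = z then {w} else {})" for v
      using wz unfolding nbrs_def by (auto simp: doubleton_eq_iff)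
    have eR: "edge_set R" using F RF' by simp
    have "good_split a b ?F ?R"
      unfolding good_split_def B' nb b1
      using RF order_trans[OF card_nbrs_mono[OF eR Diff_subset] Ra] by auto
    from saturated_nbrs[OF E U x mini deg this]
    have "a < card {u \<in> nbrs E x - U. card (nbrs {{w, z}} u) = b} \<or>
         b < card {u \<in> nbrs E x - U. card (nbrs ?R u) = a}" unfolding B' .
    moreover have "card {u \<in> nbrs E x - U. card (nbrs {{w, z}} u) = b} \<le> s x"
      unfolding s_def using fN by (intro card_mono) auto
    moreover have "card {u \<in> nbrs E x - U. card (nbrs ?R u) = a} \<le> card (nbrs E x - U - {w})"
    proof (intro card_mono)
      have "nbrs ?R w \<subset> nbrs R w" using z wz unfolding nbrs_remove_edge by (auto simp: nbrs_def)
      then have "card (nbrs ?R w) < card (nbrs R w)" by (intro psubset_card_mono finite_nbrs[OF eR])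
      then show "{u \<in> nbrs E x - U. card (nbrs ?R u) = a} \<subseteq> nbrs E x - U - {w}" using Ra[of w] by auto
    qed (use fN in auto)
    moreover have "card (nbrs E x - U - {w}) = 1" using w seq[OF x] fN unfolding s_def by simp
    ultimately show False using seq[OF x] a2 b1 by auto
  qed
  moreover have "card ?F = card U"
  proof -
    have "real (card R + card ?B) = real (card U)"
    proof -
      have "real (sum p U) + real (sum q U) = 2 * real (card U)" using spq by linarith
      moreover have "real (card ?B) = real (sum p U) / 2" "real (card R) = real (sum q U) / 2"
        using cB cR \<open>a = 1\<close> b1 by (simp_all del: of_nat_sum)
      ultimately show ?thesis by simp
    qed
    moreover have "R \<subseteq> ?F" "finite ?F" using g F unfolding good_split_def edge_set_def by auto
    then have "card ?F = card R + card ?B" by (simp add: card_Diff_subset finite_subset card_mono)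
    ultimately show ?thesis by linarith
  qed
  ultimately show "a = 1 \<and> b = 1 \<and> card ?F = card U \<and> (\<forall>x\<in>U. card (nbrs E x - U) = 2)"
    using b1 seq unfolding s_def by auto
qed

section \<open>Vertex-disjoint pieces\<close>

text \<open>A partition of the edges into pieces without common vertices.\<close>

definition decomposition :: "'a set set set \<Rightarrow> 'a set set \<Rightarrow> bool" where
  "decomposition P E \<longleftrightarrow> finite P \<and> \<Union>P = E \<and> (\<forall>p\<in>P. \<forall>q\<in>P. p \<noteq> q \<longrightarrow> \<Union>p \<inter> \<Union>q = {})"

text \<open>The star with centre \<open>c\<close> and set of leaves \<open>L\<close>.\<close>

definition star_edges :: "'a \<Rightarrow> 'a set \<Rightarrow> 'a set set" where
  "star_edges c L = (\<lambda>l. {c, l}) ` L"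

text \<open>The complete graph on the vertex set \<open>Q\<close>.\<close>

definition complete_edges :: "'a set \<Rightarrow> 'a set set" where
  "complete_edges Q = {e. e \<subseteq> Q \<and> card e = 2}"

text \<open>A star \<open>K\<^bsub>1,k\<^esub>\<close>.\<close>

definition is_star :: "nat \<Rightarrow> 'a set set \<Rightarrow> bool" where
  "is_star k p \<longleftrightarrow> (\<exists>c L. finite L \<and> card L = k \<and> c \<notin> L \<and> p = star_edges c L)"

text \<open>A complete graph \<open>K\<^sub>k\<close>.\<close>

definition is_complete :: "nat \<Rightarrow> 'a set set \<Rightarrow> bool" where
  "is_complete k p \<longleftrightarrow> (\<exists>Q. finite Q \<and> card Q = k \<and> p = complete_edges Q)"

text \<open>The cycle on four vertices, as the complete bipartite graph with parts \<open>{c, d}\<close> and \<open>L\<close>.\<close>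

definition is_four_cycle :: "'a set set \<Rightarrow> bool" where
  "is_four_cycle p \<longleftrightarrow> (\<exists>c d L. c \<noteq> d \<and> c \<notin> L \<and> d \<notin> L \<and> card L = 2 \<and>
     p = star_edges c L \<union> star_edges d L)"

lemma Union_star_edges: "L \<noteq> {} \<Longrightarrow> \<Union>(star_edges c L) = insert c L"
  unfolding star_edges_def by auto

lemma nbrs_star_edges:
  "c \<notin> L \<Longrightarrow> nbrs (star_edges c L) v = (if v = c then L else if v \<in> L then {c} else {})"
  unfolding nbrs_def star_edges_def by (auto simp: doubleton_eq_iff)

lemma card_star_edges: "card (star_edges c L) = card L"
  unfolding star_edges_def by (rule card_image) (auto simp: inj_on_def doubleton_eq_iff)

lemma Union_complete_edges:
  assumes "2 \<le> card Q"
  shows "\<Union>(complete_edges Q) = Q"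
proof (intro equalityI subsetI)
  fix v assume v: "v \<in> Q"
  have "finite Q" using assms by (metis card.infinite not_numeral_le_zero)
  then have "card (Q - {v}) \<noteq> 0" using assms v by simp
  then have "Q - {v} \<noteq> {}" by (metis card.empty)
  then obtain u where u: "u \<in> Q" "u \<noteq> v" by blast
  then have "{v, u} \<in> complete_edges Q" using v unfolding complete_edges_def by auto
  then show "v \<in> \<Union>(complete_edges Q)" by blast
qed (auto simp: complete_edges_def)

lemma nbrs_complete_edges: "nbrs (complete_edges Q) v = (if v \<in> Q then Q - {v} else {})"
  unfolding nbrs_def complete_edges_def by (auto simp: card_insert_if)

lemma card_complete_edges: "finite Q \<Longrightarrow> card (complete_edges Q) = card Q choose 2"
  unfolding complete_edges_def by (rule n_subsets)

lemma four_cycle_cards: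
  assumes "is_four_cycle p"
  shows "card p = 4" "card (\<Union>p) = 4"
proof -
  obtain c d L where h: "c \<noteq> d" "c \<notin> L" "d \<notin> L" "card L = 2" "p = star_edges c L \<union> star_edges d L"
    using assms unfolding is_four_cycle_def by auto
  have L: "finite L" "L \<noteq> {}" using h(4) by (auto intro: card_ge_0_finite)
  have "star_edges c L \<inter> star_edges d L = {}"
    using h unfolding star_edges_def by (auto simp: doubleton_eq_iff)
  moreover have "finite (star_edges c L)" "finite (star_edges d L)"
    using L unfolding star_edges_def by auto
  ultimately show "card p = 4"
    using h(4) unfolding h(5) by (simp add: card_Un_disjoint card_star_edges)
  have "\<Union>p = insert c (insert d L)" using L(2) h(5) Union_star_edges[of L] by auto
  then show "card (\<Union>p) = 4" using h L by simp
qed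

lemma nbrs_four_cycle:
  assumes "is_four_cycle p" "v \<in> \<Union>p"
  shows "card (nbrs p v) = 2"
proof -
  obtain c d L where h: "c \<noteq> d" "c \<notin> L" "d \<notin> L" "card L = 2"
    and p: "p = star_edges c L \<union> star_edges d L"
    using assms(1) unfolding is_four_cycle_def by auto
  have "L \<noteq> {}" using h(4) by auto
  then have v: "v \<in> insert c (insert d L)" using assms(2) Union_star_edges[of L] p by auto
  have "nbrs p v = (if v = c \<or> v = d then L else {c, d})"
    using h v unfolding p nbrs_Un by (auto simp: nbrs_star_edges)
  then show ?thesis using h by simp
qed

lemma nbrs_piece:
  assumes "decomposition P E" "p \<in> P" "v \<in> \<Union>p"
  shows "nbrs E v = nbrs p v"
proof -
  have "e \<in> p" if e: "e \<in> E" "v \<in> e" for e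
  proof -
    obtain q where q: "q \<in> P" "e \<in> q" using e(1) assms(1) unfolding decomposition_def by auto
    then have "v \<in> \<Union>p \<inter> \<Union>q" using e(2) assms(3) by auto
    then have "p = q" using assms(1,2) q(1) unfolding decomposition_def by auto
    then show ?thesis using q by simp
  qed
  moreover have "p \<subseteq> E" using assms unfolding decomposition_def by auto
  ultimately show ?thesis unfolding nbrs_def by auto
qed

lemma decomposition_sum_card:
  assumes E: "edge_set E" and P: "decomposition P E" and Q: "Q \<subseteq> P"
  shows "card (\<Union>Q) = (\<Sum>p\<in>Q. card p)"
proof (rule card_Union_disjoint)
  have "finite E" using E unfolding edge_set_def by auto
  then show "finite p" if "p \<in> Q" for p
    using that P Q unfolding decomposition_def by (meson Union_upper finite_subset subsetD)
  show "pairwise disjnt Q"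
  proof (rule pairwiseI)
    fix p q assume pq: "p \<in> Q" "q \<in> Q" "p \<noteq> q"
    then have d: "\<Union>p \<inter> \<Union>q = {}" using P Q unfolding decomposition_def by blast
    show "disjnt p q"
    proof (rule ccontr)
      assume "\<not> disjnt p q"
      then obtain e where e: "e \<in> p" "e \<in> q" by (auto simp: disjnt_def)
      then have "e \<in> E" using P Q pq unfolding decomposition_def by auto
      then have "e \<noteq> {}" using E unfolding edge_set_def by auto
      then show False using e d by auto
    qed
  qed
qed

text \<open>The case of equality when \<open>a = b = 1\<close>: if the two remaining neighbours of a deleted vertex
  were not adjacent, colouring a single edge red would give them different missing colours.\<close>

lemma triangle_decomposition:
  assumes E: "edge_set E" and U: "finite U"
    and mini: "\<And>U'. finite U' \<Longrightarrow> card U' < card U \<Longrightarrow> \<not> splits 1 1 (del U' E)"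
    and deg: "\<And>v. card (nbrs E v) \<le> 2"
    and cF: "card (del U E) = card U"
    and N2: "\<And>x. x \<in> U \<Longrightarrow> card (nbrs E x - U) = 2"
    and spl: "splits 1 1 (del U E)"
  shows "\<exists>P. decomposition P E \<and> (\<forall>p\<in>P. is_complete 3 p)"
proof -
  let ?F = "del U E"
  have F: "edge_set ?F" by (rule edge_set_del[OF E])
  have fN: "finite (nbrs E v)" for v by (rule finite_nbrs[OF E])
  have deg': "card (nbrs E v) \<le> 1 + 1" for v using deg[of v] by simp
  have NU: "nbrs E x \<inter> U = {}" "card (nbrs E x) = 2" if "x \<in> U" for x
  proof -
    have "card (nbrs E x - U) + card (nbrs E x \<inter> U) = card (nbrs E x)"
      using fN by (metis card_Int_Diff add.commute)
    then have "card (nbrs E x \<inter> U) = 0" "card (nbrs E x) = 2" using deg[of x] N2[OF that] by auto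
    then show "nbrs E x \<inter> U = {}" "card (nbrs E x) = 2" using fN[of x] by auto
  qed
  \<comment> \<open>the vertices adjacent to \<open>U\<close>; each turns out to have one neighbour in \<open>U\<close> and one outside, and
    every edge that avoids \<open>U\<close> joins two of them\<close>
  define S where "S = (\<Union>x\<in>U. nbrs E x)"
  have fS: "finite S" using U fN unfolding S_def by auto
  have SU: "S \<inter> U = {}" using NU unfolding S_def by auto
  obtain R where R: "good_split 1 1 ?F R" using spl unfolding splits_def by auto
  have RF: "R \<subseteq> ?F" using R unfolding good_split_def by auto
  have Fcard: "card (nbrs E w) = card (nbrs ?F w) + card (nbrs E w \<inter> U)" if "w \<notin> U" for w
    using that fN[of w] unfolding nbrs_del by (simp add: card_Int_Diff[of "nbrs E w" U] add.commute)
  have F1: "1 \<le> card (nbrs ?F w)" if "w \<in> S" for w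
  proof -
    obtain x where x: "x \<in> U" "w \<in> nbrs E x" using \<open>w \<in> S\<close> unfolding S_def by auto
    have eq: "nbrs E x - U = nbrs E x" using NU x by auto
    have sat: "1 < card {u \<in> nbrs E x. card (nbrs (?F - R) u) = 1} \<or>
         1 < card {u \<in> nbrs E x. card (nbrs R u) = 1}"
      using saturated_nbrs[OF E U x(1) mini deg' R] unfolding eq by simp
    have full: "A = nbrs E x" if "A \<subseteq> nbrs E x" "1 < card A" for A
      using that fN[of x] NU(2)[OF x(1)] card_mono[of "nbrs E x" A] by (intro card_subset_eq) auto
    have "card (nbrs (?F - R) w) = 1 \<or> card (nbrs R w) = 1"
      using sat full[of "{u \<in> nbrs E x. card (nbrs (?F - R) u) = 1}"]
        full[of "{u \<in> nbrs E x. card (nbrs R u) = 1}"] x(2) by blast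
    then show ?thesis using card_nbrs_split[OF F RF, of w] by auto
  qed
  have J1: "1 \<le> card (nbrs E w \<inter> U)" if "w \<in> S" for w
  proof -
    have "nbrs E w \<inter> U \<noteq> {}" using that nbrs_commute[of _ E w] unfolding S_def by auto
    then show ?thesis using fN[of w] by (simp add: Suc_le_eq card_gt_0_iff)
  qed
  have one: "card (nbrs ?F w) = 1" "card (nbrs E w \<inter> U) = 1" if "w \<in> S" for w
  proof -
    have "w \<notin> U" using SU that by auto
    then show "card (nbrs ?F w) = 1" "card (nbrs E w \<inter> U) = 1"
      using F1[OF that] J1[OF that] deg[of w] Fcard[of w] by simp_all
  qed
  have cS: "card S = 2 * card U"
  proof -
    have "card S = (\<Sum>w\<in>S. card (nbrs E w \<inter> U))" using one by simp
    also have "\<dots> = (\<Sum>x\<in>U. card (nbrs E x \<inter> S))" by (rule sum_card_nbrs_swap[OF fS U])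
    also have "\<dots> = (\<Sum>x\<in>U. 2)"
    proof (rule sum.cong)
      fix x assume x: "x \<in> U"
      then have "nbrs E x \<inter> S = nbrs E x" unfolding S_def by auto
      then show "card (nbrs E x \<inter> S) = 2" using NU(2)[OF x] by simp
    qed simp
    finally show ?thesis by simp
  qed
  have FS: "e \<subseteq> S" if "e \<in> ?F" for e
  proof (rule ccontr)
    assume not: "\<not> e \<subseteq> S"
    let ?V = "\<Union>?F \<union> S"
    have fV: "finite ?V" using finite_Union_edge_set[OF F] fS by auto
    let ?f = "\<lambda>v. if v \<in> S then 1 else 0 :: nat"
    have "2 * card U = (\<Sum>v\<in>S. ?f v * card (nbrs ?F v))" using one cS by simp
    also have "\<dots> \<le> (\<Sum>v\<in>?V. ?f v * card (nbrs ?F v))" using fV by (intro sum_mono2) auto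
    also have "\<dots> = (\<Sum>e\<in>?F. \<Sum>v\<in>e. ?f v)" using fV by (intro weighted_handshake[OF F]) auto
    also have "\<dots> < (\<Sum>e\<in>?F. 2)"
    proof (rule sum_strict_mono_ex1)
      show "finite ?F" using F unfolding edge_set_def by auto
      have c: "(\<Sum>v\<in>e'. ?f v) = card (e' \<inter> S)" "finite e'" "card e' = 2" if "e' \<in> ?F" for e'
      proof -
        show c2: "card e' = 2" using F that unfolding edge_set_def by auto
        then show "finite e'" by (metis card.infinite zero_neq_numeral)
        then show "(\<Sum>v\<in>e'. ?f v) = card (e' \<inter> S)" by (simp add: sum.If_cases)
      qed
      show "\<forall>e\<in>?F. (\<Sum>v\<in>e. ?f v) \<le> 2"
        using c card_mono[of _ "_ \<inter> S"] by (metis inf_le1)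
      have "card (e \<inter> S) < card e" using not c[OF that] by (intro psubset_card_mono) auto
      then show "\<exists>e\<in>?F. (\<Sum>v\<in>e. ?f v) < 2" using c[OF that] that by (intro bexI[of _ e]) simp
    qed
    finally show False using cF by simp
  qed
  have F_le1: "card (nbrs ?F v) \<le> 1" for v
  proof (cases "v \<in> S")
    case False
    then have "nbrs ?F v = {}" using FS unfolding nbrs_def by auto
    then show ?thesis by simp
  qed (use one in auto)
  have anysplit: "good_split 1 1 ?F T" if "T \<subseteq> ?F" for T
    using that order_trans[OF card_nbrs_mono[OF F] F_le1] unfolding good_split_def by auto
  have mate: "{w, w'} \<in> ?F" if x: "x \<in> U" and w: "nbrs E x = {w, w'}" "w \<noteq> w'" for x w w'
  proof (rule ccontr)
    assume nF: "{w, w'} \<notin> ?F"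
    have "w \<in> S" using x w unfolding S_def by auto
    then have "nbrs ?F w \<noteq> {}" using one(1) by force
    then obtain z where z: "{w, z} \<in> ?F" unfolding nbrs_def by auto
    have zw: "z \<noteq> w'" using z nF by auto
    \<comment> \<open>with red edge \<open>wz\<close> only, \<open>w\<close> is saturated in red and \<open>w'\<close> is not\<close>
    let ?T = "{{w, z}}"
    have zw': "z \<in> nbrs ?F w" using z unfolding nbrs_def by simp
    obtain y where "nbrs ?F w = {y}" using one(1)[OF \<open>w \<in> S\<close>] by (rule card_1_singletonE)
    with zw' have wz: "nbrs ?F w = {z}" by simp
    have T1: "nbrs ?T w' = {}" using zw w(2) unfolding nbrs_def by (auto simp: doubleton_eq_iff)
    have T2: "nbrs (?F - ?T) w = {}" using wz unfolding nbrs_def by auto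
    have eq: "nbrs E x - U = {w, w'}" using NU(1)[OF x] w by auto
    have "1 < card {u \<in> {w, w'}. card (nbrs (?F - ?T) u) = 1} \<or> 1 < card {u \<in> {w, w'}. card (nbrs ?T u) = 1}"
      using saturated_nbrs[OF E U x mini deg' anysplit[of ?T]] z unfolding eq by simp
    moreover have "card {u \<in> {w, w'}. card (nbrs (?F - ?T) u) = 1} \<le> card {w'}"
      using T2 by (intro card_mono) auto
    moreover have "card {u \<in> {w, w'}. card (nbrs ?T u) = 1} \<le> card {w}"
      using T1 by (intro card_mono) auto
    ultimately show False by simp
  qed
  define P where "P = (\<lambda>x. complete_edges (insert x (nbrs E x))) ` U"
  have card3: "card (insert x (nbrs E x)) = 3" if "x \<in> U" for x
    using NU(2)[OF that] self_notin_nbrs[OF E, of x] fN[of x] by simp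
  have UP: "\<Union>(complete_edges (insert x (nbrs E x))) = insert x (nbrs E x)" if "x \<in> U" for x
    using card3[OF that] by (intro Union_complete_edges) simp
  have "decomposition P E"
    unfolding decomposition_def
  proof (intro conjI ballI impI)
    show "finite P" using U unfolding P_def by simp
    show "\<Union>P = E"
    proof (intro equalityI subsetI)
      fix e assume "e \<in> \<Union>P"
      then obtain x where x: "x \<in> U" "e \<subseteq> insert x (nbrs E x)" "card e = 2"
        unfolding P_def complete_edges_def by auto
      obtain w w' where w: "nbrs E x = {w, w'}" "w \<noteq> w'" using NU(2)[OF x(1)] by (auto simp: card_2_iff)
      obtain y z where e: "e = {y, z}" "y \<noteq> z" using x(3) by (auto simp: card_2_iff)
      have "{w, w'} \<in> E" using mate[OF x(1) w] del_subset by blast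
      moreover have "{x, w} \<in> E" "{x, w'} \<in> E" using w(1) unfolding nbrs_def by auto
      ultimately show "e \<in> E" using x(2) e w by (auto simp: insert_commute)
    next
      fix e assume e: "e \<in> E"
      have c: "card e = 2" using e E unfolding edge_set_def by auto
      show "e \<in> \<Union>P"
      proof (cases "e \<inter> U = {}")
        case True
        then have eF: "e \<in> ?F" using e unfolding del_def by auto
        obtain y z where yz: "e = {y, z}" "y \<noteq> z" using edge_setE[OF E e] by blast
        have yS: "y \<in> S" using FS[OF eF] yz by auto
        then obtain x where x: "x \<in> U" "y \<in> nbrs E x" unfolding S_def by auto
        obtain v w where "nbrs E x = {v, w}" "v \<noteq> w" using NU(2)[OF x(1)] unfolding card_2_iff by blast
        with x(2) obtain w' where w: "nbrs E x = {y, w'}" "y \<noteq> w'"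
          by (metis insert_commute insert_iff singletonD)
        have "{z, w'} \<subseteq> nbrs ?F y" using mate[OF x(1) w] eF yz unfolding nbrs_def by auto
        moreover obtain y' where "nbrs ?F y = {y'}" using one(1)[OF yS] by (rule card_1_singletonE)
        ultimately have "z = w'" by simp
        then have "e \<in> complete_edges (insert x (nbrs E x))" using yz w c unfolding complete_edges_def by auto
        then show ?thesis using x unfolding P_def by auto
      next
        case False
        then obtain x where x: "x \<in> U" "x \<in> e" by auto
        obtain y where y: "e = {x, y}" using x(2) edge_setE[OF E e] by (metis insert_commute insert_iff singletonD)
        then have "y \<in> nbrs E x" using e unfolding nbrs_def by auto
        then have "e \<in> complete_edges (insert x (nbrs E x))" using y c unfolding complete_edges_def by auto
        then show ?thesis using x unfolding P_def by auto
      qed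
    qed
    fix p q assume pq: "p \<in> P" "q \<in> P" "p \<noteq> q"
    then obtain x y where xy: "x \<in> U" "y \<in> U" "x \<noteq> y" "p = complete_edges (insert x (nbrs E x))"
        "q = complete_edges (insert y (nbrs E y))" unfolding P_def by auto
    have "nbrs E x \<inter> nbrs E y = {}"
    proof (rule ccontr)
      assume "nbrs E x \<inter> nbrs E y \<noteq> {}"
      then obtain w where w: "w \<in> nbrs E x" "w \<in> nbrs E y" by auto
      then have "{x, y} \<subseteq> nbrs E w \<inter> U" using xy nbrs_commute[of _ E w] by auto
      moreover have "w \<in> S" using w xy unfolding S_def by auto
      then obtain y' where "nbrs E w \<inter> U = {y'}" using one(2) by (meson card_1_singletonE)
      ultimately show False using xy(3) by simp
    qed
    moreover have "y \<notin> nbrs E x" "x \<notin> nbrs E y" using NU(1) xy(1,2) by blast+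
    ultimately show "\<Union>p \<inter> \<Union>q = {}" using xy UP by auto
  qed
  moreover have "\<forall>p\<in>P. is_complete 3 p"
    using card3 fN unfolding P_def is_complete_def by blast
  ultimately show ?thesis by blast
qed

section \<open>The extremal edge sets\<close>

text \<open>The possible components of an extremal edge set. Of these \<open>K\<^sub>4\<close>, and \<open>C\<^sub>4\<close> for \<open>s \<ge> 2\<close>, survive
  deletion arguments and are excluded later by other colourings.\<close>

definition piece :: "nat \<Rightarrow> nat \<Rightarrow> 'a set set \<Rightarrow> bool" where
  "piece a b p \<longleftrightarrow> is_star (a + b + 1) p \<or>
     (a = 1 \<and> b = 1 \<and> (is_complete 3 p \<or> is_complete 4 p)) \<or>
     (a = 1 \<and> b = 0 \<and> is_four_cycle p)"

lemma ex_smallest_deletion_set: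
  assumes E: "edge_set E"
  shows "\<exists>U. finite U \<and> splits a b (del U E) \<and>
    (\<forall>U'. finite U' \<and> card U' < card U \<longrightarrow> \<not> splits a b (del U' E))"
proof -
  have "e \<inter> \<Union>E \<noteq> {}" if "e \<in> E" for e
    using edge_setE[OF E that] that by blast
  then have "del (\<Union>E) E = {}" unfolding del_def by blast
  then have "finite (\<Union>E) \<and> splits a b (del (\<Union>E) E)"
    using finite_Union_edge_set[OF E] unfolding splits_def good_split_def nbrs_def by simp
  from ex_has_least_nat[of "\<lambda>U. finite U \<and> splits a b (del U E)", OF this, of card]
  show ?thesis by (meson not_le)
qed

lemma robust_del_vertex:
  fixes E :: "'a set set"
  assumes "robust a b (Suc N) E"
  shows "robust a b N (del {v} E)"
  unfolding robust_def
proof (intro allI impI)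
  fix U :: "'a set" assume U: "finite U \<and> card U < N"
  then have "finite (U \<union> {v})" "card (U \<union> {v}) < Suc N"
    by (auto simp: card_insert_if)
  then show "\<not> splits a b (del U (del {v} E))"
    using assms unfolding robust_def del_del by blast
qed

text \<open>If no degree exceeds \<open>a + b\<close>, then the deletion of \<open>N\<close> vertices is needed only in presence of
  \<open>N (a + b + 1)\<close> edges, and equality leaves only disjoint triangles.\<close>

lemma robust_small_degree:
  fixes E :: "'a set set"
  assumes E: "edge_set E" and ab: "b \<le> a" and rob: "robust a b N E" and N: "0 < N"
    and deg: "\<And>v. card (nbrs E v) \<le> a + b"
  shows "N * (a + b + 1) \<le> card E"
    and "card E = N * (a + b + 1) \<Longrightarrow>
      a = 1 \<and> b = 1 \<and> (\<exists>P. decomposition P E \<and> (\<forall>p\<in>P. is_complete 3 p))"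
proof -
  have b: "1 \<le> b"
  proof (rule ccontr)
    assume "\<not> 1 \<le> b"
    then have b0: "b = 0" by simp
    have "good_split a b E E" using deg b0 unfolding good_split_def by (auto simp: nbrs_def)
    then have "splits a b (del {} E)" unfolding splits_def by auto
    moreover have "finite ({} :: 'a set)" "card ({} :: 'a set) < N" using N by simp_all
    ultimately show False using rob unfolding robust_def by blast
  qed
  obtain U where U0: "finite U \<and> splits a b (del U E) \<and>
      (\<forall>U'. finite U' \<and> card U' < card U \<longrightarrow> \<not> splits a b (del U' E))"
    using ex_smallest_deletion_set[OF E, of a b] ..
  then have U: "finite U" "splits a b (del U E)"
    and mini: "\<And>U'. finite U' \<Longrightarrow> card U' < card U \<Longrightarrow> \<not> splits a b (del U' E)"
    by simp_all
  have NU: "N \<le> card U" using U rob unfolding robust_def by (meson not_le)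
  note s = smallest_deletion_set[OF E U(1) b ab mini U(2) deg]
  have "N * (a + b + 1) \<le> card U * (a + b + 1)" using NU by (rule mult_le_mono1)
  then show "N * (a + b + 1) \<le> card E" using s(1) by simp
  assume eq: "card E = N * (a + b + 1)"
  then have "card U * (a + b + 1) \<le> N * (a + b + 1)" using s(1) by simp
  then have "card U \<le> N" by (simp only: mult_le_cancel2)
  then have cU: "card U = N" using NU by simp
  then have ne: "U \<noteq> {}" using N by auto
  have h: "a = 1" "b = 1" "card (del U E) = card U" "\<And>x. x \<in> U \<Longrightarrow> card (nbrs E x - U) = 2"
    using s(2) ne eq cU by auto
  have "\<exists>P. decomposition P E \<and> (\<forall>p\<in>P. is_complete 3 p)"
  proof (rule triangle_decomposition[OF E U(1) _ _ h(3,4)])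
    show "card (nbrs E v) \<le> 2" for v using deg[of v] h(1,2) by simp
  qed (use mini U(2) h(1,2) in simp_all)
  then show "a = 1 \<and> b = 1 \<and> (\<exists>P. decomposition P E \<and> (\<forall>p\<in>P. is_complete 3 p))"
    using h by simp
qed

lemma robust_card_ge:
  assumes "edge_set E" "b \<le> a" "robust a b N E"
  shows "N * (a + b + 1) \<le> card E"
  using assms
proof (induction N arbitrary: E)
  case (Suc N)
  show ?case
  proof (cases "\<forall>v. card (nbrs E v) \<le> a + b")
    case True
    then show ?thesis using robust_small_degree(1)[OF Suc.prems] by auto
  next
    case False
    then obtain v where "a + b < card (nbrs E v)" by (auto simp: not_le)
    then have v: "a + b + 1 \<le> card (nbrs E v)" by simp
    have "N * (a + b + 1) \<le> card (del {v} E)"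
      by (rule Suc.IH[OF edge_set_del[OF Suc.prems(1)] Suc.prems(2) robust_del_vertex[OF Suc.prems(3)]])
    then show ?thesis using v card_del_vertex[OF Suc.prems(1), of v] by simp
  qed
qed simp

text \<open>Every piece has a small vertex set whose removal leaves only edges that may all be blue.\<close>

lemma piece_hit:
  assumes "piece a b q"
  shows "\<exists>H. finite H \<and> H \<subseteq> \<Union>q \<and> card H * (a + b + 1) \<le> card q \<and>
    (\<forall>w. card (nbrs (del H q) w) \<le> b) \<and> (is_star (a + b + 1) q \<longrightarrow> del H q = {})"
proof -
  have *: ?thesis if star: "is_star (a + b + 1) q"
  proof -
    obtain c L where L: "finite L" "card L = a + b + 1" "c \<notin> L" "q = star_edges c L"
      using star unfolding is_star_def by blast
    have "L \<noteq> {}" using L(2) by auto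
    have "del {c} q = {}" unfolding L(4) del_def star_edges_def by auto
    then show ?thesis
      using L \<open>L \<noteq> {}\<close> by (intro exI[of _ "{c}"]) (auto simp: Union_star_edges card_star_edges nbrs_def)
  qed
  consider "is_star (a + b + 1) q" | "a = 1" "b = 1" "is_complete 3 q" "\<not> is_star (a + b + 1) q"
    | "a = 1" "b = 1" "is_complete 4 q" "\<not> is_star (a + b + 1) q"
    | "a = 1" "b = 0" "is_four_cycle q" "\<not> is_star (a + b + 1) q"
    using assms unfolding piece_def by blast
  then show ?thesis
  proof cases
    case 1
    then show ?thesis by (rule *)
  next
    case 2
    obtain Q where Q: "finite Q" "card Q = 3" "q = complete_edges Q" using 2 unfolding is_complete_def by auto
    obtain x where x: "x \<in> Q" using Q by fastforce
    have "card (nbrs (del {x} q) w) \<le> 1" for w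
      using Q x unfolding Q(3) nbrs_del nbrs_complete_edges by auto
    moreover have "card q = 3" using Q by (simp add: card_complete_edges choose_two)
    moreover have "x \<in> \<Union>q" using Q x by (simp add: Union_complete_edges)
    ultimately show ?thesis using 2 by (intro exI[of _ "{x}"]) auto
  next
    case 3
    obtain Q where Q: "finite Q" "card Q = 4" "q = complete_edges Q" using 3 unfolding is_complete_def by auto
    obtain H where H: "H \<subseteq> Q" "card H = 2" using obtain_subset_with_card_n[of 2 Q] Q by auto
    have fH: "finite H" using H Q finite_subset by blast
    have cd: "card (Q - H) = 2" using H Q fH by (simp add: card_Diff_subset)
    have "card (nbrs (del H q) w) \<le> 1" for w
    proof (cases "w \<in> Q - H")
      case True
      have "nbrs (del H q) w = Q - H - {w}" using True unfolding Q(3) nbrs_del nbrs_complete_edges by auto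
      then show ?thesis using cd True by simp
    next
      case False
      then have "nbrs (del H q) w = {}" unfolding Q(3) nbrs_del nbrs_complete_edges by auto
      then show ?thesis by simp
    qed
    moreover have "card q = 6" using Q by (simp add: card_complete_edges choose_two)
    moreover have "H \<subseteq> \<Union>q" using Q H by (simp add: Union_complete_edges)
    ultimately show ?thesis using 3 H fH by (intro exI[of _ H]) auto
  next
    case 4
    obtain c d L where h: "c \<noteq> d" "c \<notin> L" "d \<notin> L" "card L = 2" "q = star_edges c L \<union> star_edges d L"
      using 4 unfolding is_four_cycle_def by auto
    have "L \<noteq> {}" using h(4) by auto
    have "card q = 4" by (rule four_cycle_cards(1)[OF 4(3)])
    moreover have "del {c, d} q = {}" unfolding h(5) del_def star_edges_def by auto
    moreover have "{c, d} \<subseteq> \<Union>q" using h \<open>L \<noteq> {}\<close> Union_star_edges[of L] by auto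
    ultimately show ?thesis using 4 h(1)
      by (intro exI[of _ "{c, d}"]) (auto simp: nbrs_def)
  qed
qed

text \<open>The step that makes extremal edge sets disjoint unions: when a vertex \<open>v\<close> of degree
  \<open>a + b + 1\<close> shares the leaf \<open>u\<close> with a star centred at \<open>c\<close>, the deletion of \<open>u\<close> does the work of the
  deletion of both centres. What remains at \<open>c\<close> is coloured first, then \<open>v\<close> is added.\<close>

lemma shared_leaf_splits:
  assumes E: "edge_set E" and ab: "b \<le> a"
    and P: "decomposition P (del {v} E)" and p: "p \<in> P" "p = star_edges c Lp"
    and Lp: "finite Lp" "card Lp = a + b + 1" "c \<notin> Lp"
    and u: "u \<in> Lp" "u \<in> nbrs E v" and cv: "c \<notin> nbrs E v"
    and dv: "card (nbrs E v) = a + b + 1"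
    and k2: "1 \<le> a"
    and exc: "a = 1 \<Longrightarrow> b = 0 \<Longrightarrow> nbrs E v \<noteq> Lp"
    and h: "\<And>q. q \<in> P - {p} \<Longrightarrow> h q \<subseteq> \<Union>q \<and> (\<forall>w. card (nbrs (del (h q) q) w) \<le> b) \<and>
        (nbrs E v \<inter> \<Union>q \<noteq> {} \<longrightarrow> del (h q) q = {})"
  shows "splits a b (del (insert u (\<Union>q\<in>P - {p}. h q)) E)"
proof -
  define U where "U = insert u (\<Union>q\<in>P - {p}. h q)"
  let ?L = "nbrs E v" and ?E' = "del {v} E"
  let ?F = "del U E" and ?D = "del {v} (del U E)"
  have E': "edge_set ?E'" by (rule edge_set_del[OF E])
  have fL: "finite ?L" by (rule finite_nbrs[OF E])
  have D: "edge_set ?D" by (intro edge_set_del E)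
  have DE: "?D = del U ?E'" by (simp add: del_del Un_commute)
  have Up: "\<Union>p = insert c Lp" using p(2) u(1) Union_star_edges[of Lp c] by auto
  have disj: "\<Union>q \<inter> \<Union>p = {}" if "q \<in> P - {p}" for q
    using that p P unfolding decomposition_def by blast
  have hq: "h q \<inter> \<Union>p = {}" if "q \<in> P - {p}" for q
    using h[OF that] disj[OF that] by blast
  have U_p: "w \<in> U \<longleftrightarrow> w = u" if "w \<in> insert c Lp" for w
    using hq that u(1) unfolding U_def Up by blast
  have cU: "c \<notin> U" using U_p[of c] u(1) Lp(3) by auto
  have vE': "v \<notin> \<Union>?E'" unfolding del_def by auto
  have nD_p: "nbrs ?D w = (if w = c then Lp - {u} else if w \<in> Lp - {u} then {c} else {})"
    if "w \<in> insert c Lp" for w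
  proof -
    have 1: "nbrs ?E' w = nbrs p w" using nbrs_piece[OF P p(1)] that Up by simp
    have 2: "Lp - U = Lp - {u}" using U_p by blast
    show ?thesis
      using that u(1) Lp(3) cU unfolding DE nbrs_del[of U] 1 U_p[OF that]
      by (auto simp: p(2) nbrs_star_edges 2)
  qed
  have nD_q: "nbrs ?D w \<subseteq> nbrs (del (h q) q) w" if "q \<in> P - {p}" "w \<in> \<Union>q" for q w
  proof -
    have "nbrs ?E' w = nbrs q w" using nbrs_piece[OF P _ that(2)] that(1) by simp
    moreover have "h q \<subseteq> U" using that unfolding U_def by blast
    ultimately show ?thesis unfolding DE nbrs_del by auto
  qed
  have nD_0: "nbrs ?D w = {}" if "w \<notin> \<Union>?E'" for w
    using that unfolding DE del_def nbrs_def by blast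
  have cases: "w \<in> insert c Lp \<or> (\<exists>q\<in>P - {p}. w \<in> \<Union>q) \<or> w \<notin> \<Union>?E'" for w
    using P Up unfolding decomposition_def by blast
  have cLu: "card (Lp - {u}) = a + b" using Lp u(1) by simp
  \<comment> \<open>\<open>a\<close> of the remaining edges at \<open>c\<close> are red and \<open>b\<close> are blue; all other edges are blue\<close>
  obtain S where S: "S \<subseteq> Lp - {u}" "card S = a" "finite S"
    using obtain_subset_with_card_n[of a "Lp - {u}"] cLu by auto
  define R where "R = star_edges c S"
  have cS: "c \<notin> S" using S Lp by auto
  have nR: "nbrs R w = (if w = c then S else if w \<in> S then {c} else {})" for w
    unfolding R_def using nbrs_star_edges[OF cS] by simp
  have nB: "nbrs (?D - R) w = nbrs ?D w - nbrs R w" for w unfolding nbrs_def by auto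
  have cT: "card (Lp - {u} - S) = b" using cLu S by (simp add: card_Diff_subset)
  have fT: "finite (Lp - {u} - S)" using Lp by simp
  have RD: "R \<subseteq> ?D"
  proof
    fix e assume "e \<in> R"
    then obtain l where l: "e = {c, l}" "l \<in> S" unfolding R_def star_edges_def by auto
    then have "l \<in> nbrs ?D c" using nD_p[of c] S by auto
    then show "e \<in> ?D" using l unfolding nbrs_def by simp
  qed
  have gs: "good_split a b ?D R"
    unfolding good_split_def
  proof (intro conjI allI)
    fix w
    show "card (nbrs R w) \<le> a" using S k2 unfolding nR by auto
    consider "w = c" | "w \<in> Lp" "w \<noteq> c" | "w \<notin> insert c Lp" by auto
    then show "card (nbrs (?D - R) w) \<le> b"
    proof cases
      case 1
      then show ?thesis using nD_p[of c] cT unfolding nB nR by simp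
    next
      case 2
      have "nbrs (?D - R) w \<subseteq> (if w \<in> Lp - {u} - S then {c} else {})"
        using 2 nD_p[of w] unfolding nB nR by auto
      moreover have "1 \<le> b" if "w \<in> Lp - {u} - S" using that cT fT by (metis One_nat_def Suc_leI card_gt_0_iff empty_iff)
      ultimately show ?thesis
        by (cases "w \<in> Lp - {u} - S") (auto dest: card_mono[rotated])
    next
      case 3
      have nb: "nbrs (?D - R) w \<subseteq> nbrs ?D w" unfolding nB by auto
      consider q where "q \<in> P - {p}" "w \<in> \<Union>q" | "w \<notin> \<Union>?E'" using cases[of w] 3 by blast
      then show ?thesis
      proof cases
        case (1 q)
        have "q \<subseteq> E" using 1(1) P unfolding decomposition_def del_def by blast
        then have "edge_set (del (h q) q)" by (intro edge_set_del edge_set_subset[OF E])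
        then have "card (nbrs (?D - R) w) \<le> card (nbrs (del (h q) q) w)"
          using nb nD_q[OF 1] by (intro card_mono finite_nbrs) auto
        then show ?thesis using h[OF 1(1)] by (meson le_trans)
      next
        case 2
        then show ?thesis using nb nD_0[of w] by simp
      qed
    qed
  qed (rule RD)
  have nF: "nbrs ?F v \<subseteq> ?L - {u}" unfolding nbrs_del U_def by auto
  have cLu': "card (?L - {u}) = a + b" using dv u(2) fL by simp
  have deg1: "nbrs R y = (if y \<in> S then {c} else {})"
      "nbrs (?D - R) y = (if y \<in> Lp - {u} - S then {c} else {})" if y: "y \<in> nbrs ?F v" for y
  proof -
    have yL: "y \<in> ?L" "y \<noteq> c" "y \<noteq> u" using y nF cv by auto
    then show "nbrs R y = (if y \<in> S then {c} else {})" unfolding nR by simp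
    consider "y \<in> Lp" | q where "q \<in> P - {p}" "y \<in> \<Union>q" "y \<notin> Lp" | "y \<notin> \<Union>?E'" "y \<notin> Lp"
      using cases[of y] yL by blast
    then show "nbrs (?D - R) y = (if y \<in> Lp - {u} - S then {c} else {})"
    proof cases
      case 1
      then show ?thesis using nD_p[of y] yL unfolding nB nR by auto
    next
      case (2 q)
      then have "nbrs ?D y = {}" using nD_q[of q y] h[of q] yL by (auto simp: nbrs_def)
      then show ?thesis using 2 unfolding nB by simp
    next
      case 3
      then show ?thesis using nD_0[of y] unfolding nB by simp
    qed
  qed
  have exc': False if "y \<in> nbrs ?F v" "y \<in> S" "a = 1" "b = 0" for y
  proof -
    have uy: "{u, y} \<subseteq> ?L" "{u, y} \<subseteq> Lp" "u \<noteq> y" using that nF u S by auto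
    then have "card {u, y} = 2" by simp
    moreover have "card ?L = 2" "card Lp = 2" using that Lp dv by auto
    ultimately have "{u, y} = ?L" "{u, y} = Lp"
      using card_subset_eq[OF fL uy(1)] card_subset_eq[OF Lp(1) uy(2)] by (simp_all only:)
    then have "?L = Lp" by (rule HOL.trans[OF sym])
    then show False using exc that by simp
  qed
  have "splits a b ?F"
  proof (rule splits_extend_vertex[OF edge_set_del[OF E] gs])
    show "card (nbrs ?F v) \<le> a + b" using card_mono[OF _ nF] fL cLu' by simp
    fix y assume y: "y \<in> nbrs ?F v" "card (nbrs R y) = a" "card (nbrs (?D - R) y) = b"
    then have "y \<in> S" using deg1(1)[OF y(1)] k2 by (auto split: if_splits)
    then have "a = 1" "b = 0" using y deg1[OF y(1)] by auto
    then show False using exc' y(1) \<open>y \<in> S\<close> by blast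
  next
    let ?PR = "{y \<in> nbrs ?F v. card (nbrs (?D - R) y) = b}"
    consider "b = 0" | "b = 1" | "2 \<le> b" by linarith
    then show "card ?PR \<le> a"
    proof cases
      case 1
      have "card ?PR \<le> card (?L - {u})" using nF fL by (intro card_mono) auto
      then show ?thesis using 1 cLu' by simp
    next
      case 2
      have "?PR \<subseteq> Lp - {u} - S" using deg1(2) 2 by (auto split: if_splits)
      then have "card ?PR \<le> b" using card_mono[OF fT] cT by metis
      then show ?thesis using ab by simp
    next
      case 3
      have "?PR = {}" using deg1(2) 3 by (auto split: if_splits)
      then show ?thesis by (simp only: card.empty le0)
    qed
    let ?PB = "{y \<in> nbrs ?F v. card (nbrs R y) = a}"
    consider "2 \<le> a" | "a = 1" "b = 0" | "a = 1" "1 \<le> b" using k2 by linarith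
    then show "card ?PB \<le> b"
    proof cases
      case 1
      have "?PB = {}" using deg1(1) 1 by (auto split: if_splits)
      then show ?thesis by (simp only: card.empty le0)
    next
      case 2
      have "?PB = {}" using deg1(1) 2 exc' by (auto split: if_splits)
      then show ?thesis by (simp only: card.empty le0)
    next
      case 3
      have "?PB \<subseteq> S" using deg1(1) 3 by (auto split: if_splits)
      then have "card ?PB \<le> 1" using card_mono[OF S(3)] S(2) 3 by metis
      then show ?thesis using 3 by simp
    qed
  qed
  then show ?thesis unfolding U_def .
qed

lemma decomposition_insert:
  assumes P: "decomposition P E" and q: "\<Union>q \<inter> \<Union>E = {}"
  shows "decomposition (insert q P) (E \<union> q)"
proof -
  have "\<Union>p \<subseteq> \<Union>E" if "p \<in> P" for p using that P unfolding decomposition_def by blast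
  then have "\<Union>q \<inter> \<Union>p = {}" "\<Union>p \<inter> \<Union>q = {}" if "p \<in> P" for p using that q by blast+
  then show ?thesis using P unfolding decomposition_def by auto
qed

lemma edges_split_vertex: "E = del {v} E \<union> star_edges v (nbrs E v)" if "edge_set E"
proof (intro equalityI subsetI)
  fix e assume e: "e \<in> E"
  obtain x y where xy: "e = {x, y}" "x \<noteq> y" using edge_setE[OF \<open>edge_set E\<close> e] by blast
  show "e \<in> del {v} E \<union> star_edges v (nbrs E v)"
  proof (cases "v \<in> e")
    case True
    then obtain u where "e = {v, u}" using xy by blast
    then show ?thesis using e unfolding star_edges_def nbrs_def by blast
  qed (use e in \<open>auto simp: del_def\<close>)
qed (auto simp: del_def star_edges_def nbrs_def)

text \<open>Adding a vertex whose neighbours all lie in one piece enlarges that piece.\<close>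

lemma decomposition_attach:
  assumes E: "edge_set E" and P: "decomposition P (del {v} E)" and p: "p \<in> P"
    and L: "nbrs E v \<subseteq> \<Union>p"
  shows "decomposition (insert (p \<union> star_edges v (nbrs E v)) (P - {p})) E"
proof -
  let ?q = "p \<union> star_edges v (nbrs E v)" and ?E0 = "\<Union>(P - {p})"
  have P0: "decomposition (P - {p}) ?E0" using P unfolding decomposition_def by auto
  have "\<Union>r \<inter> \<Union>p = {}" if "r \<in> P - {p}" for r using that P p unfolding decomposition_def by blast
  then have "\<Union>p \<inter> \<Union>?E0 = {}" by blast
  moreover have "v \<notin> \<Union>?E0" using P unfolding decomposition_def del_def by blast
  moreover have "\<Union>?q \<subseteq> insert v (\<Union>p)" using L unfolding star_edges_def by auto
  ultimately have "\<Union>?q \<inter> \<Union>?E0 = {}" by blast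
  from decomposition_insert[OF P0 this]
  have "decomposition (insert ?q (P - {p})) (?E0 \<union> ?q)" .
  moreover have "?E0 \<union> ?q = del {v} E \<union> star_edges v (nbrs E v)"
    using P p unfolding decomposition_def by blast
  ultimately show ?thesis using edges_split_vertex[OF E, of v] by simp
qed

text \<open>If the ends of an edge \<open>yz\<close> of a piece have no neighbours in it besides each other and \<open>v\<close>, then
  the piece is neither \<open>K\<^bsub>1,3\<^esub>\<close> nor \<open>K\<^sub>4\<close>, in which every edge has an end of degree three; hence it is
  the triangle \<open>yzv\<close>.\<close>

lemma triangle_extension:
  assumes q: "piece 1 1 q" "{y, z} \<in> q" and yz: "y \<noteq> z"
    and ny: "nbrs q y \<subseteq> {z, v}" and nz: "nbrs q z \<subseteq> {y, v}"
  shows "v \<in> nbrs q y" "v \<in> nbrs q z"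
proof -
  have cy: "card (nbrs q y) \<le> 2" using ny card_mono[of "{z, v}" "nbrs q y"] card_insert_le_m1[of 2 "{v}" z] by simp
  have cz: "card (nbrs q z) \<le> 2" using nz card_mono[of "{y, v}" "nbrs q z"] card_insert_le_m1[of 2 "{v}" y] by simp
  have "\<not> is_star 3 q"
  proof
    assume "is_star 3 q"
    then obtain c L where L: "card L = 3" "c \<notin> L" "q = star_edges c L" unfolding is_star_def by auto
    have "c = y \<or> c = z" using q(2) unfolding L(3) star_edges_def by (auto simp: doubleton_eq_iff)
    then show False using cy cz L(1) nbrs_star_edges[OF L(2)] unfolding L(3) by auto
  qed
  then obtain Q where Q: "finite Q" "card Q = 3 \<or> card Q = 4" "q = complete_edges Q"
    using q(1) unfolding piece_def is_complete_def by (auto simp: eval_nat_numeral)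
  have yzQ: "y \<in> Q" "z \<in> Q" using q(2) unfolding Q(3) complete_edges_def by auto
  have n: "nbrs q y = Q - {y}" "nbrs q z = Q - {z}"
    using yzQ by (simp_all add: Q(3) nbrs_complete_edges)
  have "card (nbrs q y) = card Q - 1" unfolding n(1) by (rule card_Diff_singleton[OF yzQ(1)])
  then have "card Q = 3" using Q(2) cy by linarith
  then have "card (Q - {y, z}) = 1" using Q(1) yzQ yz by (simp add: card_Diff_subset)
  then obtain u where "Q - {y, z} = {u}" by (rule card_1_singletonE)
  then have u: "u \<in> Q" "u \<noteq> y" "u \<noteq> z" by auto
  then have "u = v" using ny n(1) by auto
  then show "v \<in> nbrs q y" "v \<in> nbrs q z" using u n by auto
qed

lemma extremal_decomposition:
  assumes "edge_set E" "b \<le> a" "robust a b N E" "card E = N * (a + b + 1)"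
  shows "\<exists>P. decomposition P E \<and> (\<forall>p\<in>P. piece a b p)"
  using assms
proof (induction N arbitrary: E)
  case 0
  then have "E = {}" unfolding edge_set_def by simp
  then show ?case by (intro exI[of _ "{}"]) (simp add: decomposition_def)
next
  case (Suc N)
  note E = Suc.prems(1) and ab = Suc.prems(2) and rob = Suc.prems(3) and cE = Suc.prems(4)
  let ?k = "a + b + 1"
  show ?case
  proof (cases "\<forall>v. card (nbrs E v) \<le> a + b")
    case True
    then have "a = 1 \<and> b = 1 \<and> (\<exists>P. decomposition P E \<and> (\<forall>p\<in>P. is_complete 3 p))"
      using robust_small_degree(2)[OF E ab rob _ _ cE] by simp
    then show ?thesis unfolding piece_def by auto
  next
    case False
    have peel: "card (nbrs E w) = ?k \<and> robust a b N (del {w} E) \<and> card (del {w} E) = N * ?k"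
      if w: "?k \<le> card (nbrs E w)" for w
    proof -
      have r: "robust a b N (del {w} E)" by (rule robust_del_vertex[OF rob])
      have "N * ?k \<le> card (del {w} E)" by (rule robust_card_ge[OF edge_set_del[OF E] ab r])
      then show ?thesis using r w card_del_vertex[OF E, of w] cE by simp
    qed
    have degE: "card (nbrs E w) \<le> ?k" for w using peel[of w] by (cases "?k \<le> card (nbrs E w)") auto
    have IH: "\<exists>P. decomposition P (del {w} E) \<and> (\<forall>p\<in>P. piece a b p)" if "card (nbrs E w) = ?k" for w
      using Suc.IH[OF edge_set_del[OF E] ab] peel[of w] that by simp
    obtain v where "a + b < card (nbrs E v)" using False by (auto simp: not_le)
    then have dv: "card (nbrs E v) = ?k" using peel[of v] by simp
    let ?L = "nbrs E v" and ?E' = "del {v} E"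
    have E': "edge_set ?E'" by (rule edge_set_del[OF E])
    have fL: "finite ?L" by (rule finite_nbrs[OF E])
    have vL: "v \<notin> ?L" by (rule self_notin_nbrs[OF E])
    have vE': "v \<notin> \<Union>?E'" unfolding del_def by auto
    obtain P where P: "decomposition P ?E'" and pcs: "\<And>p. p \<in> P \<Longrightarrow> piece a b p"
      using IH[OF dv] by blast
    have fp: "edge_set p" if "p \<in> P" for p
      using that P E' unfolding decomposition_def by (auto intro: edge_set_subset)
    have touch: "nbrs E u = insert v (nbrs p u)" "v \<notin> nbrs p u" "card (nbrs p u) \<le> a + b"
      if "p \<in> P" "u \<in> \<Union>p" "u \<in> ?L" for p u
    proof -
      have uv: "u \<noteq> v" using that vL by auto
      have n: "nbrs p u = nbrs E u - {v}"
        using nbrs_piece[OF P that(1,2)] uv unfolding nbrs_del by simp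
      moreover have "v \<in> nbrs E u" using that(3) nbrs_commute[of v E u] by simp
      ultimately show "nbrs E u = insert v (nbrs p u)" "v \<notin> nbrs p u" by auto
      then show "card (nbrs p u) \<le> a + b" using degE[of u] finite_nbrs[OF fp[OF that(1)], of u] by simp
    qed
    show ?thesis
    proof (cases "?L \<inter> \<Union>?E' = {}")
      case True
      then have "\<Union>(star_edges v ?L) \<inter> \<Union>?E' = {}" using vE' unfolding star_edges_def by auto
      from decomposition_insert[OF P this]
      have "decomposition (insert (star_edges v ?L) P) E" using edges_split_vertex[OF E, of v] by simp
      moreover have "piece a b (star_edges v ?L)"
        using fL vL dv unfolding piece_def is_star_def by blast
      ultimately show ?thesis using pcs by blast
    next
      case False
      show ?thesis
      proof (cases "\<exists>p\<in>P. \<not> is_star ?k p \<and> ?L \<inter> \<Union>p \<noteq> {}")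
        case True
        then obtain p w where p: "p \<in> P" "\<not> is_star ?k p" and w: "w \<in> ?L" "w \<in> \<Union>p" by blast
        note t = touch[OF p(1) w(2,1)]
        have "is_complete 3 p \<and> a = 1 \<and> b = 1"
        proof -
          have "\<not> (a = 1 \<and> b = 0 \<and> is_four_cycle p)" using t(3) nbrs_four_cycle[OF _ w(2)] by auto
          moreover have "\<not> (a = 1 \<and> b = 1 \<and> is_complete 4 p)"
          proof
            assume h: "a = 1 \<and> b = 1 \<and> is_complete 4 p"
            then obtain Q where Q: "finite Q" "card Q = 4" "p = complete_edges Q" unfolding is_complete_def by auto
            have "w \<in> Q" using w(2) Q by (simp add: Union_complete_edges)
            then show False using t(3) Q h by (simp add: nbrs_complete_edges)
          qed
          ultimately show ?thesis using pcs[OF p(1)] p(2) unfolding piece_def by blast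
        qed
        then have a1: "a = 1" "b = 1" and "is_complete 3 p" by auto
        then obtain Q where Q: "finite Q" "card Q = 3" "p = complete_edges Q" unfolding is_complete_def by auto
        have UQ: "\<Union>p = Q" using Q by (simp add: Union_complete_edges)
        have wQ: "w \<in> Q" using w(2) UQ by simp
        then have "card (Q - {w}) = 2" using Q by simp
        then obtain y z where yz: "Q - {w} = {y, z}" "y \<noteq> z" unfolding card_2_iff by blast
        have yzw: "y \<in> Q" "z \<in> Q" "y \<noteq> w" "z \<noteq> w" "Q = {w, y, z}" using yz wQ by blast+
        have vQ: "v \<notin> Q" using vE' UQ P p(1) unfolding decomposition_def by blast
        have np: "nbrs p x = (if x \<in> Q then Q - {x} else {})" for x unfolding Q(3) by (rule nbrs_complete_edges)
        have "card (nbrs E w) = ?k" using t(1,2) np[of w] wQ Q a1 by simp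
        \<comment> \<open>deleting \<open>w\<close> instead of \<open>v\<close> gives a second decomposition\<close>
        then obtain P2 where P2: "decomposition P2 (del {w} E)" and pcs2: "\<And>p. p \<in> P2 \<Longrightarrow> piece a b p"
          using IH by blast
        have "{y, z} \<in> p" using yz(2) yzw unfolding Q(3) complete_edges_def by auto
        then have "{y, z} \<in> del {w} E" using P p(1) yzw unfolding decomposition_def del_def by blast
        then obtain q where q: "q \<in> P2" "{y, z} \<in> q" using P2 unfolding decomposition_def by blast
        have nq: "nbrs q x \<subseteq> insert v (Q - {x}) - {w}" if x: "x = y \<or> x = z" for x
        proof -
          have xq: "x \<in> \<Union>q" and xQ: "x \<in> Q" "x \<noteq> w" using q(2) x yzw by auto
          have "nbrs q x = nbrs E x - {w}"
            using nbrs_piece[OF P2 q(1) xq] xQ unfolding nbrs_del by simp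
          moreover have "x \<noteq> v" using xQ vQ by blast
          then have "nbrs E x \<subseteq> insert v (nbrs ?E' x)" unfolding nbrs_del by auto
          moreover have "x \<in> \<Union>p" using xQ UQ by simp
          then have "nbrs ?E' x = Q - {x}" using nbrs_piece[OF P p(1)] xQ np by simp
          ultimately show ?thesis by blast
        qed
        have "v \<in> nbrs q y" "v \<in> nbrs q z"
          using triangle_extension[of q y z v] pcs2[OF q(1)] a1 q(2) yz(2) nq[of y] nq[of z] yzw(5) by auto
        moreover have "nbrs q x \<subseteq> nbrs E x" for x
          using q(1) P2 unfolding decomposition_def del_def by (intro nbrs_mono) blast
        ultimately have "y \<in> ?L" "z \<in> ?L" using nbrs_commute[of v E] by blast+
        then have "Q \<subseteq> ?L" using w(1) yzw by auto
        moreover have "card Q = card ?L" using dv a1 Q(2) by simp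
        ultimately have LQ: "?L = Q" using card_subset_eq[OF fL] by blast
        have "p \<union> star_edges v ?L = complete_edges (insert v Q)"
        proof (intro equalityI subsetI)
          fix e assume "e \<in> p \<union> star_edges v ?L"
          then show "e \<in> complete_edges (insert v Q)"
            using vQ unfolding LQ Q(3) complete_edges_def star_edges_def by (auto simp: card_insert_if)
        next
          fix e assume e: "e \<in> complete_edges (insert v Q)"
          show "e \<in> p \<union> star_edges v ?L"
          proof (cases "v \<in> e")
            case True
            have "card e = 2" "e \<subseteq> insert v Q" using e unfolding complete_edges_def by auto
            then obtain u where "e = {v, u}" "u \<noteq> v" using True unfolding card_2_iff by blast
            then show ?thesis using \<open>e \<subseteq> insert v Q\<close> unfolding LQ star_edges_def by auto
          qed (use e in \<open>auto simp: Q(3) complete_edges_def\<close>)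
        qed
        moreover have "is_complete 4 (complete_edges (insert v Q))"
          using Q vQ unfolding is_complete_def by (intro exI[of _ "insert v Q"]) simp
        ultimately have "piece a b (p \<union> star_edges v ?L)" using a1 unfolding piece_def by simp
        moreover have "decomposition (insert (p \<union> star_edges v ?L) (P - {p})) E"
          by (rule decomposition_attach[OF E P p(1)]) (simp add: LQ UQ)
        ultimately show ?thesis using pcs by blast
      next
        case stars: False
        obtain u p where up: "u \<in> ?L" "p \<in> P" "u \<in> \<Union>p"
          using False P unfolding decomposition_def by blast
        have "is_star ?k p" using stars up by blast
        then obtain c Lp where Lp: "finite Lp" "card Lp = ?k" "c \<notin> Lp" "p = star_edges c Lp"
          unfolding is_star_def by (elim exE conjE)
        have "Lp \<noteq> {}" using Lp(2) by auto
        then have Up: "\<Union>p = insert c Lp" using Lp(4) by (simp add: Union_star_edges)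
        have "nbrs p c = Lp" unfolding Lp(4) by (simp add: nbrs_star_edges[OF Lp(3)])
        then have cL: "c \<notin> ?L" using touch(3)[OF up(2), of c] Up Lp(2) by auto
        have "u \<in> insert c Lp" using up(3) Up by simp
        then have uLp: "u \<in> Lp" using up(1) cL by blast
        have a1: "1 \<le> a"
        proof -
          have "u \<noteq> c" using uLp Lp(3) by blast
          then have "card (nbrs p u) = 1" unfolding Lp(4) using uLp by (simp add: nbrs_star_edges[OF Lp(3)])
          then show ?thesis using touch(3)[OF up(2,3,1)] ab by linarith
        qed
        show ?thesis
        proof (cases "a = 1 \<and> b = 0 \<and> ?L = Lp")
          case True
          have "p \<subseteq> ?E'" using up(2) P unfolding decomposition_def by blast
          moreover have "c \<in> \<Union>p" unfolding Up by simp
          ultimately have "c \<in> \<Union>?E'" by blast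
          then have "c \<noteq> v" using vE' by metis
          then have "is_four_cycle (p \<union> star_edges v ?L)"
            unfolding is_four_cycle_def
            using True Lp vL by (intro exI[of _ c] exI[of _ v] exI[of _ Lp]) simp
          then have "piece a b (p \<union> star_edges v ?L)" using True unfolding piece_def by simp
          moreover have "decomposition (insert (p \<union> star_edges v ?L) (P - {p})) E"
            by (rule decomposition_attach[OF E P up(2)]) (use True Up in auto)
          ultimately show ?thesis using pcs by blast
        next
          case ncyc: False
          have "\<exists>h. \<forall>q\<in>P. finite (h q) \<and> h q \<subseteq> \<Union>q \<and> card (h q) * ?k \<le> card q \<and>
              (\<forall>w. card (nbrs (del (h q) q) w) \<le> b) \<and> (is_star ?k q \<longrightarrow> del (h q) q = {})"
            by (intro bchoice ballI piece_hit pcs)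
          then obtain h where h0: "\<forall>q\<in>P. finite (h q) \<and> h q \<subseteq> \<Union>q \<and> card (h q) * ?k \<le> card q \<and>
              (\<forall>w. card (nbrs (del (h q) q) w) \<le> b) \<and> (is_star ?k q \<longrightarrow> del (h q) q = {})" ..
          note h = bspec[OF h0]
          let ?U = "insert u (\<Union>q\<in>P - {p}. h q)"
          have fP: "finite P" using P unfolding decomposition_def by simp
          have "splits a b (del ?U E)"
          proof (rule shared_leaf_splits[OF E ab P up(2) Lp(4) Lp(1,2,3) uLp up(1) cL dv a1])
            show "nbrs E v \<noteq> Lp" if "a = 1" "b = 0" using ncyc that by simp
            fix q assume q: "q \<in> P - {p}"
            then have "is_star ?k q" if "?L \<inter> \<Union>q \<noteq> {}" using stars that by blast
            then show "h q \<subseteq> \<Union>q \<and> (\<forall>w. card (nbrs (del (h q) q) w) \<le> b) \<and>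
              (?L \<inter> \<Union>q \<noteq> {} \<longrightarrow> del (h q) q = {})" using h[of q] q by blast
          qed
          moreover have "finite ?U" using fP h by auto
          moreover have "card ?U \<le> N"
          proof -
            have "card ?U \<le> Suc (card (\<Union>q\<in>P - {p}. h q))" by (rule card_insert_le_m1) simp_all
            also have "card (\<Union>q\<in>P - {p}. h q) \<le> (\<Sum>q\<in>P - {p}. card (h q))"
              using fP by (intro card_UN_le) auto
            finally have "card ?U * ?k \<le> (1 + (\<Sum>q\<in>P - {p}. card (h q))) * ?k"
              by (intro mult_le_mono1) simp
            also have "\<dots> = card p + (\<Sum>q\<in>P - {p}. card (h q) * ?k)"
              unfolding Lp(4) card_star_edges Lp(2) by (simp only: add_mult_distrib sum_distrib_right mult_1)
            also have "\<dots> \<le> card p + (\<Sum>q\<in>P - {p}. card q)"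
              using h by (intro add_left_mono sum_mono) auto
            also have "\<dots> = (\<Sum>q\<in>P. card q)" using fP up(2) by (simp add: sum.remove)
            also have "\<dots> = card ?E'"
              using decomposition_sum_card[OF E' P subset_refl] P unfolding decomposition_def by simp
            also have "\<dots> = N * ?k" using peel[of v] dv by simp
            finally show ?thesis by (simp only: mult_le_cancel2)
          qed
          ultimately show ?thesis using rob unfolding robust_def by (meson le_imp_less_Suc)
        qed
      qed
    qed
  qed
qed

section \<open>From colourings to splittings\<close>

lemma simple_graph_edge_set: "simple_graph G \<Longrightarrow> edge_set (edges G)"
  unfolding simple_graph_def edge_set_def by (auto intro: finite_subset[of _ "Pow (verts G)"])

text \<open>Disjoint monochromatic stars are bounded by a weighting of the vertices: if each
  monochromatic star \<open>K\<^bsub>1,n\<^esub>\<close> has weight at least \<open>K\<close>, then \<open>s\<close> disjoint ones have weight at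
  least \<open>K s\<close>.\<close>

lemma mono_stars_weight:
  fixes w :: "'a \<Rightarrow> nat"
  assumes mono: "mono_copy G c col (copies s (star_graph n))" and fin: "finite (verts G)"
    and w: "\<And>x L. L \<subseteq> {u. {x, u} \<in> edges G \<and> c {x, u} = col} \<Longrightarrow> card L = n \<Longrightarrow> finite L \<Longrightarrow> x \<notin> L \<Longrightarrow>
              K \<le> w x + sum w L"
  shows "K * s \<le> sum w (verts G)"
proof -
  let ?A = "{..<s} \<times> {0..n}"
  obtain H where H: "subgraph H G" "\<forall>e\<in>edges H. c e = col" "H \<simeq> copies s (star_graph n)"
    using mono unfolding mono_copy_def by blast
  obtain f where f: "bij_betw f (verts H) ?A"
    and fe: "(\<lambda>e. f ` e) ` edges H = edges (copies s (star_graph n))"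
    using H(3) unfolding isomorphic_def by (auto simp: copies_def star_graph_def)
  have HG: "verts H \<subseteq> verts G" "edges H \<subseteq> edges G" and sH: "\<And>e. e \<in> edges H \<Longrightarrow> e \<subseteq> verts H"
    using H(1) unfolding subgraph_def simple_graph_def by auto
  define g where "g = inv_into (verts H) f"
  have g: "bij_betw g ?A (verts H)" unfolding g_def by (rule bij_betw_inv_into[OF f])
  have inj: "inj_on g ?A" using g by (rule bij_betw_imp_inj_on)
  have ge: "{g (i, 0), g (i, j)} \<in> edges H" if "i < s" "j \<in> {1..n}" for i j
  proof -
    have "{0, j} \<in> edges (star_graph n)" using that unfolding star_graph_def by auto
    then have "Pair i ` {0, j} \<in> edges (copies s (star_graph n))"
      using that unfolding copies_def by (simp del: image_insert image_empty) blast
    then obtain e where e: "e \<in> edges H" "f ` e = Pair i ` {0, j}" unfolding fe[symmetric] by auto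
    have "g ` f ` e = e"
      using sH[OF e(1)] bij_betw_inv_into_left[OF f] unfolding g_def image_image by force
    then show ?thesis using e by simp
  qed
  have "K \<le> (\<Sum>j\<in>{0..n}. w (g (i, j)))" if i: "i < s" for i
  proof -
    let ?L = "(\<lambda>j. g (i, j)) ` {1..n}"
    have ij: "inj_on (\<lambda>j. g (i, j)) {0..n}"
      using inj i unfolding inj_on_def by auto
    then have ij1: "inj_on (\<lambda>j. g (i, j)) {1..n}" by (rule inj_on_subset) auto
    have "K \<le> w (g (i, 0)) + sum w ?L"
    proof (rule w)
      show "?L \<subseteq> {u. {g (i, 0), u} \<in> edges G \<and> c {g (i, 0), u} = col}"
        using ge[OF i] HG(2) H(2) by blast
      show "card ?L = n" using ij1 by (simp add: card_image)
      show "g (i, 0) \<notin> ?L"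
      proof
        assume "g (i, 0) \<in> ?L"
        then obtain j where j: "j \<in> {1..n}" "g (i, 0) = g (i, j)" by auto
        then have "0 = j" using inj_onD[OF ij, of 0 j] by auto
        then show False using j by simp
      qed
    qed simp
    also have "\<dots> = (\<Sum>j\<in>{0..n}. w (g (i, j)))"
      using ij1 by (simp add: sum.reindex sum.atLeast_Suc_atMost[of 0 n])
    finally show ?thesis .
  qed
  then have "(\<Sum>i<s. K) \<le> (\<Sum>i<s. \<Sum>j\<in>{0..n}. w (g (i, j)))" by (intro sum_mono) auto
  also have "\<dots> = (\<Sum>x\<in>?A. w (g x))" by (simp add: sum.cartesian_product case_prod_unfold)
  also have "\<dots> = sum w (verts H)" using g by (intro sum.reindex_bij_betw)
  also have "\<dots> \<le> sum w (verts G)" using HG(1) fin by (intro sum_mono2) auto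
  finally show ?thesis by (simp add: mult.commute)
qed

text \<open>The colouring that avoids both star forests. Edges at \<open>S\<close> get the first colour, edges at \<open>T\<close>
  the second, and what is left is split. In addition a separate set \<open>Q\<close> of vertices may carry
  edges of the first colour only; as its stars have at least three vertices, \<open>Q\<close> can contain no
  more than \<open>card Q div 3\<close> of them.\<close>

lemma colouring_without_stars:
  assumes G: "simple_graph G" and cols: "col \<noteq> col'"
    and fin: "finite S" "finite T" "finite Q"
    and Q: "\<And>e. e \<in> edges G \<Longrightarrow> e \<inter> Q \<noteq> {} \<Longrightarrow> e \<subseteq> Q" and Qn: "Q = {} \<or> 2 \<le> n"
    and s: "3 * card S + card Q < 3 * s" and t: "card T < t"
    and ab: "a < n" "b < m" and R: "good_split a b (del (S \<union> T \<union> Q) (edges G)) R"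
  shows "\<exists>c. \<not> mono_copy G c col (copies s (star_graph n)) \<and> \<not> mono_copy G c col' (copies t (star_graph m))"
proof -
  let ?E = "edges G"
  let ?F = "del (S \<union> T \<union> Q) ?E"
  define c where "c e = (if e \<inter> (S \<union> Q) \<noteq> {} then col else if e \<inter> T \<noteq> {} then col' else if e \<in> R then col else col')" for e
  have E: "edge_set ?E" by (rule simple_graph_edge_set[OF G])
  have F: "edge_set ?F" by (rule edge_set_del[OF E])
  have RF: "R \<subseteq> ?F" and Ra: "\<And>v. card (nbrs R v) \<le> a" and Bb: "\<And>v. card (nbrs (?F - R) v) \<le> b"
    using R unfolding good_split_def by auto
  have eR: "edge_set R" "edge_set (?F - R)" using F RF by (auto intro: edge_set_subset)
  have fV: "finite (verts G)" using G unfolding simple_graph_def by simp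
  have "\<not> mono_copy G c col (copies s (star_graph n))"
  proof
    assume mono: "mono_copy G c col (copies s (star_graph n))"
    let ?w = "\<lambda>v. (if v \<in> S then 3 else 0) + (if v \<in> Q then 1 else 0 :: nat)"
    have "3 * s \<le> sum ?w (verts G)"
    proof (rule mono_stars_weight[OF mono fV])
      fix x L assume L: "L \<subseteq> {u. {x, u} \<in> ?E \<and> c {x, u} = col}" "card L = n" "finite L" "x \<notin> L"
      have sum_insert: "?w x + sum ?w L = sum ?w (insert x L)" using L by simp
      consider (S) "insert x L \<inter> S \<noteq> {}" | (Q) "insert x L \<inter> S = {}" "insert x L \<inter> Q \<noteq> {}"
        | (0) "insert x L \<inter> S = {}" "insert x L \<inter> Q = {}" by blast
      then show "3 \<le> ?w x + sum ?w L"
      proof cases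
        case S
        then obtain y where y: "y \<in> insert x L" "y \<in> S" by auto
        have "?w y \<le> sum ?w (insert x L)" using L(3) y(1) by (intro member_le_sum) auto
        then show ?thesis using y(2) sum_insert by simp
      next
        case Q': Q
        have xLQ: "insert x L \<subseteq> Q"
        proof -
          obtain y where y: "y \<in> insert x L" "y \<in> Q" using Q' by auto
          have "x \<in> Q"
          proof (cases "y = x")
            case False
            then have "{x, y} \<in> ?E" using y L(1) by auto
            then show ?thesis using Q[of "{x, y}"] y by auto
          qed (use y in simp)
          moreover have "u \<in> Q" if "u \<in> L" for u
            using Q[of "{x, u}"] \<open>x \<in> Q\<close> that L(1) by auto
          ultimately show ?thesis by auto
        qed
        have "card (insert x L) = (\<Sum>v\<in>insert x L. 1)" by simp
        also have "\<dots> \<le> sum ?w (insert x L)" using xLQ by (intro sum_mono) auto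
        finally have "card (insert x L) \<le> sum ?w (insert x L)" .
        moreover have "3 \<le> card (insert x L)" using L Qn Q'(2) xLQ by auto
        ultimately show ?thesis using sum_insert by linarith
      next
        case 0
        have "L \<subseteq> nbrs R x"
        proof
          fix u assume u: "u \<in> L"
          then have "c {x, u} = col" "{x, u} \<inter> (S \<union> Q) = {}" using L(1) 0 by auto
          then show "u \<in> nbrs R x" using cols unfolding c_def nbrs_def by (auto split: if_splits)
        qed
        then have "n \<le> a" using card_mono[OF finite_nbrs[OF eR(1)]] Ra[of x] L(2) by (meson le_trans)
        then show ?thesis using ab by simp
      qed
    qed
    moreover have "sum ?w (verts G) \<le> 3 * card S + card Q"
    proof -
      have "sum ?w (verts G) \<le> sum ?w (verts G \<union> S \<union> Q)" using fV fin by (intro sum_mono2) auto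
      also have "\<dots> = 3 * card S + card Q"
      proof -
        have "(verts G \<union> S \<union> Q) \<inter> {v. v \<in> S} = S" "(verts G \<union> S \<union> Q) \<inter> {v. v \<in> Q} = Q" by auto
        then show ?thesis
          using fV fin by (simp only: sum.distrib sum.If_cases finite_Un simp_thms sum_constant) simp
      qed
      finally show ?thesis .
    qed
    ultimately show False using s by simp
  qed
  moreover have "\<not> mono_copy G c col' (copies t (star_graph m))"
  proof
    assume mono: "mono_copy G c col' (copies t (star_graph m))"
    let ?w = "\<lambda>v. if v \<in> T then 1 else 0 :: nat"
    have "1 * t \<le> sum ?w (verts G)"
    proof (rule mono_stars_weight[OF mono fV])
      fix x L assume L: "L \<subseteq> {u. {x, u} \<in> ?E \<and> c {x, u} = col'}" "card L = m" "finite L" "x \<notin> L"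
      have sum_insert: "?w x + sum ?w L = sum ?w (insert x L)" using L by simp
      show "1 \<le> ?w x + sum ?w L"
      proof (cases "insert x L \<inter> T = {}")
        case False
        then obtain y where y: "y \<in> insert x L" "y \<in> T" by auto
        have "?w y \<le> sum ?w (insert x L)" using L(3) y(1) by (intro member_le_sum) auto
        then show ?thesis using y(2) sum_insert by simp
      next
        case True
        have "L \<subseteq> nbrs (?F - R) x"
        proof
          fix u assume u: "u \<in> L"
          then have "c {x, u} = col'" "{x, u} \<inter> T = {}" "{x, u} \<in> ?E" using L(1) True by auto
          then show "u \<in> nbrs (?F - R) x"
            using cols unfolding c_def nbrs_def del_def by (auto split: if_splits)
        qed
        then have "m \<le> b" using card_mono[OF finite_nbrs[OF eR(2)]] Bb[of x] L(2) by (meson le_trans)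
        then show ?thesis using ab by simp
      qed
    qed
    moreover have "sum ?w (verts G) \<le> card T"
    proof -
      have "sum ?w (verts G) \<le> sum ?w (verts G \<union> T)" using fV fin by (intro sum_mono2) auto
      also have "\<dots> = card T"
        using fV fin by (simp add: sum.If_cases Int_absorb1)
      finally show ?thesis .
    qed
    ultimately show False using t by simp
  qed
  ultimately show ?thesis by blast
qed

lemma split_card_bound:
  assumes "finite U" "card U \<le> i + j"
  obtains S T where "U = S \<union> T" "card S \<le> i" "card T \<le> j" "finite S" "finite T"
proof -
  obtain S where S: "S \<subseteq> U" "card S = min i (card U)" "finite S"
    using obtain_subset_with_card_n[of "min i (card U)" U] by auto
  have "card (U - S) \<le> j" using S assms by (simp add: card_Diff_subset min_def split: if_splits)
  then show ?thesis using that[of S "U - S"] S assms by auto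
qed

lemma arrows_robust:
  assumes G: "simple_graph G" and arr: "arrows G (copies s (star_graph n)) (copies t (star_graph m))"
    and pos: "1 \<le> s" "1 \<le> t" "1 \<le> m" "1 \<le> n"
  shows "robust (n - 1) (m - 1) (s + t - 1) (edges G)"
  unfolding robust_def
proof (intro allI impI notI)
  fix U assume U: "finite U \<and> card U < s + t - 1" and spl: "splits (n - 1) (m - 1) (del U (edges G))"
  have fU: "finite U" and cU: "card U \<le> (s - 1) + (t - 1)" using U pos by linarith+
  obtain S T where ST: "U = S \<union> T" "card S \<le> s - 1" "card T \<le> t - 1" "finite S" "finite T"
    by (rule split_card_bound[OF fU cU])
  obtain R where R: "good_split (n - 1) (m - 1) (del (S \<union> T \<union> {}) (edges G)) R"
    using spl ST(1) unfolding splits_def by auto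
  have "\<exists>c. \<not> mono_copy G c Red (copies s (star_graph n)) \<and> \<not> mono_copy G c Blue (copies t (star_graph m))"
    by (rule colouring_without_stars[OF G _ ST(4,5) _ _ _ _ _ _ _ R]) (use ST pos in auto)
  then show False using arr unfolding arrows_def by blast
qed

text \<open>A piece on four vertices with as many edges as two stars can be coloured in one colour, and
  then contributes only one star of that colour.\<close>

lemma colouring_with_four_vertex_piece:
  assumes G: "simple_graph G" and cols: "col \<noteq> col'"
    and P: "decomposition P (edges G)" "\<And>p. p \<in> P \<Longrightarrow> piece a b p"
    and p0: "p0 \<in> P" "card (\<Union>p0) = 4" "2 * (a + b + 1) \<le> card p0"
    and cE: "card (edges G) = (s + t - 1) * (a + b + 1)"
    and st: "2 \<le> s" "1 \<le> t" "2 \<le> n" "b < m"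
  shows "\<exists>c. \<not> mono_copy G c col (copies s (star_graph n)) \<and> \<not> mono_copy G c col' (copies t (star_graph m))"
proof -
  let ?k = "a + b + 1" and ?E = "edges G" and ?Q = "\<Union>p0"
  have E: "edge_set ?E" by (rule simple_graph_edge_set[OF G])
  have "\<exists>h. \<forall>q\<in>P. finite (h q) \<and> h q \<subseteq> \<Union>q \<and> card (h q) * ?k \<le> card q \<and>
      (\<forall>w. card (nbrs (del (h q) q) w) \<le> b) \<and> (is_star ?k q \<longrightarrow> del (h q) q = {})"
    by (intro bchoice ballI piece_hit P(2))
  then obtain h where h0: "\<forall>q\<in>P. finite (h q) \<and> h q \<subseteq> \<Union>q \<and> card (h q) * ?k \<le> card q \<and>
      (\<forall>w. card (nbrs (del (h q) q) w) \<le> b) \<and> (is_star ?k q \<longrightarrow> del (h q) q = {})" ..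
  note h = bspec[OF h0]
  let ?U = "\<Union>q\<in>P - {p0}. h q"
  have fP: "finite P" using P(1) unfolding decomposition_def by simp
  have fU: "finite ?U" using fP h by auto
  have "card ?U * ?k \<le> (\<Sum>q\<in>P - {p0}. card (h q)) * ?k"
    using fP by (intro mult_le_mono1 card_UN_le) auto
  also have "\<dots> \<le> (\<Sum>q\<in>P - {p0}. card q)"
    using h unfolding sum_distrib_right by (intro sum_mono) auto
  finally have "card ?U * ?k + 2 * ?k \<le> (\<Sum>q\<in>P. card q)"
    using fP p0(1,3) by (simp add: sum.remove)
  also have "\<dots> = (s + t - 1) * ?k"
    using decomposition_sum_card[OF E P(1) subset_refl] P(1) cE unfolding decomposition_def by simp
  finally have "(card ?U + 2) * ?k \<le> (s + t - 1) * ?k" by (simp only: add_mult_distrib)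
  then have "card ?U + 2 \<le> s + t - 1" by (simp only: mult_le_cancel2)
  then have cU: "card ?U \<le> (s - 2) + (t - 1)" using st by linarith
  obtain S T where ST: "?U = S \<union> T" "card S \<le> s - 2" "card T \<le> t - 1" "finite S" "finite T"
    by (rule split_card_bound[OF fU cU])
  let ?F = "del (S \<union> T \<union> ?Q) ?E"
  have F: "edge_set ?F" by (rule edge_set_del[OF E])
  have fin: "finite ?Q" using p0(2) by (metis card.infinite zero_neq_numeral)
  have small: "card (nbrs (?F - {}) w) \<le> b" for w
  proof (cases "\<exists>q\<in>P - {p0}. w \<in> \<Union>q")
    case True
    then obtain q where q: "q \<in> P" "q \<noteq> p0" "w \<in> \<Union>q" by blast
    have "nbrs ?E w = nbrs q w" by (rule nbrs_piece[OF P(1) q(1,3)])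
    moreover have "h q \<subseteq> S \<union> T" using q unfolding ST(1)[symmetric] by blast
    ultimately have "nbrs (?F - {}) w \<subseteq> nbrs (del (h q) q) w" by (auto simp: nbrs_del)
    moreover have "q \<subseteq> ?E" using q(1) P(1) unfolding decomposition_def by blast
    then have "edge_set (del (h q) q)" by (intro edge_set_del edge_set_subset[OF E])
    ultimately have "card (nbrs (?F - {}) w) \<le> card (nbrs (del (h q) q) w)"
      by (intro card_mono finite_nbrs)
    then show ?thesis using h[OF q(1)] by (meson le_trans)
  next
    case False
    have "nbrs (?F - {}) w = {}"
    proof (rule ccontr)
      assume "nbrs (?F - {}) w \<noteq> {}"
      then obtain u where u: "{w, u} \<in> ?E" "w \<notin> ?Q" unfolding nbrs_def del_def by auto
      then obtain q where "q \<in> P" "{w, u} \<in> q" using P(1) unfolding decomposition_def by blast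
      then show False using False u(2) by blast
    qed
    then show ?thesis by simp
  qed
  show ?thesis
  proof (rule colouring_without_stars[OF G cols ST(4,5) fin, of _ _ _ 0 b])
    fix e assume e: "e \<in> ?E" "e \<inter> ?Q \<noteq> {}"
    then obtain q where q: "q \<in> P" "e \<in> q" using P(1) unfolding decomposition_def by blast
    then have "q = p0" using e(2) p0(1) P(1) unfolding decomposition_def by blast
    then show "e \<subseteq> ?Q" using q by blast
  next
    show "good_split 0 b ?F {}" unfolding good_split_def using small by (auto simp: nbrs_def)
  qed (use ST st p0(2) in auto)
qed

section \<open>Isomorphisms with the named graphs\<close>

text \<open>The graph without isolated vertices that has the given edges.\<close>

definition graph_of :: "'a set set \<Rightarrow> 'a ugraph" where
  "graph_of E = \<lparr>verts = \<Union>E, edges = E\<rparr>"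

lemma graph_of_edges:
  fixes G :: "'a ugraph"
  assumes "simple_graph G"
  shows "graph_of (edges G) = G"
proof -
  have "\<Union>(edges G) = verts G" using assms unfolding simple_graph_def by blast
  then show ?thesis unfolding graph_of_def by simp
qed

lemma simple_graph_of: "edge_set E \<Longrightarrow> simple_graph (graph_of E)"
  using finite_Union_edge_set[of E] unfolding simple_graph_def graph_of_def edge_set_def by auto

lemma decomposition_isomorphic_copies:
  assumes P: "decomposition P E" and iso: "\<And>p. p \<in> P \<Longrightarrow> graph_of p \<simeq> A"
  shows "graph_of E \<simeq> copies (card P) A"
proof -
  have fP: "finite P" and UP: "\<Union>P = E" and disj: "\<And>p q. p \<in> P \<Longrightarrow> q \<in> P \<Longrightarrow> p \<noteq> q \<Longrightarrow> \<Union>p \<inter> \<Union>q = {}"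
    using P unfolding decomposition_def by auto
  have "\<exists>f. \<forall>p\<in>P. bij_betw (f p) (\<Union>p) (verts A) \<and> (\<lambda>e. f p ` e) ` p = edges A"
    using iso unfolding isomorphic_def graph_of_def by (intro bchoice) auto
  then obtain f where f: "\<forall>p\<in>P. bij_betw (f p) (\<Union>p) (verts A) \<and> (\<lambda>e. f p ` e) ` p = edges A" ..
  obtain i where i: "bij_betw i P {..<card P}"
    using ex_bij_betw_finite_nat[OF fP] by (auto simp: atLeast0LessThan)
  have iP: "i ` P = {..<card P}" by (rule bij_betw_imp_surj_on[OF i])
  have fbij: "bij_betw (f p) (\<Union>p) (verts A)" and fed: "(\<lambda>e. f p ` e) ` p = edges A" if "p \<in> P" for p
    using f that by simp_all
  note fim = bij_betw_imp_surj_on[OF fbij] and finj = bij_betw_imp_inj_on[OF fbij]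
  define pc where "pc v = (THE p. p \<in> P \<and> v \<in> \<Union>p)" for v
  have pc: "pc v = p" if "p \<in> P" "v \<in> \<Union>p" for p v
    unfolding pc_def using that disj by (intro the_equality) blast+
  define F where "F v = (i (pc v), f (pc v) v)" for v
  have Fp: "F v = (i p, f p v)" if "p \<in> P" "v \<in> \<Union>p" for p v
    unfolding F_def using pc[OF that] by simp
  have Fe: "F ` e = Pair (i p) ` (f p ` e)" if "p \<in> P" "e \<in> p" for p e
    using Fp[OF that(1)] that(2) unfolding image_image by (intro image_cong) auto
  have "bij_betw F (\<Union>E) ({..<card P} \<times> verts A)"
  proof (rule bij_betw_imageI)
    show "inj_on F (\<Union>E)"
    proof (rule inj_onI)
      fix v w assume v: "v \<in> \<Union>E" and w: "w \<in> \<Union>E" and eq: "F v = F w"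
      obtain p where p: "p \<in> P" "v \<in> \<Union>p" using v UP by blast
      obtain q where q: "q \<in> P" "w \<in> \<Union>q" using w UP by blast
      have "i p = i q" "f p v = f q w" using eq Fp[OF p] Fp[OF q] by auto
      moreover from this have pq: "p = q"
        using inj_onD[OF bij_betw_imp_inj_on[OF i]] p(1) q(1) by simp
      ultimately show "v = w" using inj_onD[OF finj[OF p(1)], of v w] p(2) q(2) by simp
    qed
    show "F ` \<Union>E = {..<card P} \<times> verts A"
    proof (intro equalityI subsetI)
      fix y assume "y \<in> F ` \<Union>E"
      then obtain v p where p: "p \<in> P" "v \<in> \<Union>p" "y = F v" using UP by blast
      have "i p \<in> {..<card P}" using iP p(1) by blast
      moreover have "f p v \<in> verts A" using fim[OF p(1)] p(2) by (metis imageI)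
      ultimately show "y \<in> {..<card P} \<times> verts A" using p(3) Fp[OF p(1,2)] by simp
    next
      fix y assume "y \<in> {..<card P} \<times> verts A"
      then obtain j x where y: "y = (j, x)" "j \<in> {..<card P}" "x \<in> verts A" by auto
      obtain p where p: "p \<in> P" "i p = j" using y(2) unfolding iP[symmetric] by blast
      have "x \<in> f p ` \<Union>p" using y(3) fim[OF p(1)] by simp
      then obtain v where v: "v \<in> \<Union>p" "f p v = x" by (metis imageE)
      have "F v = y" using Fp[OF p(1) v(1)] p v y by simp
      moreover have "v \<in> \<Union>E" using v(1) p(1) UP by blast
      ultimately show "y \<in> F ` \<Union>E" by blast
    qed
  qed
  moreover have "(\<lambda>e. F ` e) ` E = {Pair j ` e | j e. j < card P \<and> e \<in> edges A}"
  proof (intro equalityI subsetI)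
    fix e' assume "e' \<in> (\<lambda>e. F ` e) ` E"
    then obtain p e where p: "p \<in> P" "e \<in> p" "e' = F ` e" using UP by blast
    have "i p < card P" using iP p(1) by blast
    moreover have "f p ` e \<in> edges A" using fed[OF p(1)] p(2) by blast
    moreover have "e' = Pair (i p) ` (f p ` e)" using p(3) Fe[OF p(1,2)] by (rule HOL.trans)
    ultimately show "e' \<in> {Pair j ` e | j e. j < card P \<and> e \<in> edges A}"
      by (intro CollectI exI conjI)
  next
    fix e' assume "e' \<in> {Pair j ` e | j e. j < card P \<and> e \<in> edges A}"
    then obtain j d where d: "e' = Pair j ` d" "j < card P" "d \<in> edges A" by blast
    have "j \<in> i ` P" using iP d(2) by simp
    then obtain p where p: "p \<in> P" "i p = j" by blast
    have "d \<in> (\<lambda>e. f p ` e) ` p" using fed[OF p(1)] d(3) by simp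
    then obtain e where e: "e \<in> p" "f p ` e = d" by blast
    have "e' = F ` e" using Fe[OF p(1) e(1)] p(2) e(2) d(1) by simp
    moreover have "e \<in> E" using p(1) e(1) UP by blast
    ultimately show "e' \<in> (\<lambda>e. F ` e) ` E" by (rule image_eqI)
  qed
  ultimately show ?thesis
    unfolding isomorphic_def graph_of_def copies_def by (intro exI[of _ F]) simp
qed

lemma isomorphic_disjoint_union:
  assumes 1: "graph_of E1 \<simeq> A" and 2: "graph_of E2 \<simeq> B" and disj: "\<Union>E1 \<inter> \<Union>E2 = {}"
  shows "graph_of (E1 \<union> E2) \<simeq> A \<squnion>\<^sub>g B"
proof -
  obtain f where f: "bij_betw f (\<Union>E1) (verts A)" "(\<lambda>e. f ` e) ` E1 = edges A"
    using 1 unfolding isomorphic_def graph_of_def by auto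
  obtain g where g: "bij_betw g (\<Union>E2) (verts B)" "(\<lambda>e. g ` e) ` E2 = edges B"
    using 2 unfolding isomorphic_def graph_of_def by auto
  define F where "F v = (if v \<in> \<Union>E1 then Inl (f v) else Inr (g v))" for v
  have F1: "F v = Inl (f v)" if "v \<in> \<Union>E1" for v using that unfolding F_def by simp
  have F2: "F v = Inr (g v)" if "v \<in> \<Union>E2" for v
  proof -
    have "v \<notin> \<Union>E1" using that disj by blast
    then show ?thesis unfolding F_def by simp
  qed
  have e1: "F ` X = Inl ` f ` X" if "X \<subseteq> \<Union>E1" for X
    unfolding image_image using that by (intro image_cong refl F1) blast
  have e2: "F ` X = Inr ` g ` X" if "X \<subseteq> \<Union>E2" for X
    unfolding image_image using that by (intro image_cong refl F2) blast
  have "bij_betw F (\<Union>E1 \<union> \<Union>E2) (Inl ` verts A \<union> Inr ` verts B)"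
  proof (rule bij_betw_combine)
    show "bij_betw F (\<Union>E1) (Inl ` verts A)"
      using f(1) F1 e1[of "\<Union>E1"] unfolding bij_betw_def inj_on_def by simp
    show "bij_betw F (\<Union>E2) (Inr ` verts B)"
      using g(1) F2 e2[of "\<Union>E2"] unfolding bij_betw_def inj_on_def by simp
  qed auto
  moreover have "(\<lambda>e. F ` e) ` E1 = (\<lambda>e. Inl ` e) ` edges A"
    unfolding f(2)[symmetric] image_image[of _ _ E1] by (intro image_cong refl e1 Union_upper)
  moreover have "(\<lambda>e. F ` e) ` E2 = (\<lambda>e. Inr ` e) ` edges B"
    unfolding g(2)[symmetric] image_image[of _ _ E2] by (intro image_cong refl e2 Union_upper)
  ultimately show ?thesis
    unfolding isomorphic_def graph_of_def disjoint_union_def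
    by (intro exI[of _ F]) (simp add: image_Un)
qed

lemma star_isomorphic:
  assumes "is_star k p" "1 \<le> k"
  shows "graph_of p \<simeq> star_graph k"
proof -
  obtain c L where L: "finite L" "card L = k" "c \<notin> L" "p = star_edges c L"
    using assms(1) unfolding is_star_def by (elim exE conjE)
  have "L \<noteq> {}" using L assms(2) by auto
  have "card {1..k} = card L" using L(2) by simp
  then obtain g where g: "bij_betw g L {1..k}" using finite_same_card_bij[of L "{1..k}"] L by auto
  define f where "f v = (if v = c then 0 else g v)" for v
  have fL: "f v = g v" if "v \<in> L" for v using that L(3) unfolding f_def by auto
  have fc: "f c = 0" unfolding f_def by simp
  have "bij_betw f ({c} \<union> L) ({0} \<union> {1..k})"
  proof (rule bij_betw_combine)
    show "bij_betw f L {1..k}" using g fL by (simp cong: bij_betw_cong)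
  qed (use fc in \<open>auto simp: bij_betw_def\<close>)
  moreover have "{c} \<union> L = \<Union>p" using L(4) \<open>L \<noteq> {}\<close> by (simp add: Union_star_edges)
  moreover have "{0} \<union> {1..k} = {0..k}" by auto
  moreover have "(\<lambda>e. f ` e) ` p = {{0, i} | i. i \<in> {1..k}}"
  proof -
    have "(\<lambda>e. f ` e) ` p = (\<lambda>l. {0, g l}) ` L"
      unfolding L(4) star_edges_def image_image using fc fL by (intro image_cong) auto
    also have "\<dots> = (\<lambda>i. {0, i}) ` (g ` L)" unfolding image_image by simp
    also have "g ` L = {1..k}" using g unfolding bij_betw_def by simp
    finally show ?thesis by (simp only: Setcompr_eq_image)
  qed
  ultimately show ?thesis unfolding isomorphic_def graph_of_def star_graph_def
    by (intro exI[of _ f]) simp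
qed

lemma complete_isomorphic:
  assumes "is_complete k p" "2 \<le> k"
  shows "graph_of p \<simeq> complete_graph k"
proof -
  obtain Q where Q: "finite Q" "card Q = k" "p = complete_edges Q"
    using assms(1) unfolding is_complete_def by blast
  have "card Q = card {..<k}" using Q(2) by simp
  then obtain f where f: "bij_betw f Q {..<k}" using finite_same_card_bij[of Q "{..<k}"] Q by auto
  have inj: "inj_on f Q" and im: "f ` Q = {..<k}" using f unfolding bij_betw_def by auto
  have "(\<lambda>e. f ` e) ` p = {e. e \<subseteq> {..<k} \<and> card e = 2}"
  proof (intro equalityI subsetI)
    fix d assume "d \<in> (\<lambda>e. f ` e) ` p"
    then obtain e where e: "d = f ` e" "e \<subseteq> Q" "card e = 2" unfolding Q(3) complete_edges_def by blast
    then show "d \<in> {e. e \<subseteq> {..<k} \<and> card e = 2}"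
      using im card_image[OF inj_on_subset[OF inj e(2)]] by auto
  next
    fix d assume "d \<in> {e. e \<subseteq> {..<k} \<and> card e = 2}"
    then have d: "d \<subseteq> f ` Q" "card d = 2" using im by auto
    obtain e where e: "e \<subseteq> Q" "d = f ` e" using d(1) unfolding subset_image_iff by blast
    then have "card e = 2" using d(2) card_image[OF inj_on_subset[OF inj e(1)]] by simp
    then show "d \<in> (\<lambda>e. f ` e) ` p" using e unfolding Q(3) complete_edges_def by blast
  qed
  moreover have "\<Union>p = Q" using Q assms(2) by (simp add: Union_complete_edges)
  ultimately show ?thesis using f unfolding isomorphic_def graph_of_def complete_graph_def
    by (intro exI[of _ f]) simp
qed

lemma four_cycle_isomorphic:
  assumes "is_four_cycle p"
  shows "graph_of p \<simeq> cycle_graph 4"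
proof -
  obtain c d L where h: "c \<noteq> d" "c \<notin> L" "d \<notin> L" "card L = 2" "p = star_edges c L \<union> star_edges d L"
    using assms unfolding is_four_cycle_def by auto
  obtain x y where L: "L = {x, y}" "x \<noteq> y" using h(4) unfolding card_2_iff by blast
  have ne: "c \<noteq> x" "c \<noteq> y" "d \<noteq> x" "d \<noteq> y" using h L by auto
  define f where "f v = (if v = c then 0 else if v = x then 1 else if v = d then 2 else 3 :: nat)" for v
  have fv: "f c = 0" "f x = 1" "f d = 2" "f y = 3" using ne h(1) L(2) unfolding f_def by auto
  have p: "p = {{c, x}, {c, y}, {d, x}, {d, y}}" unfolding h(5) L(1) star_edges_def by auto
  have lt4: "{..<4} = {0, 1, 2, 3 :: nat}" by auto
  have bij: "bij_betw f (\<Union>p) {..<4}"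
    using fv ne h(1) L(2) unfolding p lt4 bij_betw_def by (auto simp: inj_on_def)
  have "{{i, Suc i mod 4} | i. i < 4} = (\<lambda>i. {i, Suc i mod 4}) ` {..<4}" by (auto simp: image_def)
  moreover have "Suc 0 mod 4 = 1" "Suc 1 mod 4 = 2" "Suc 2 mod 4 = 3" "Suc 3 mod 4 = (0 :: nat)" by simp_all
  ultimately have "{{i, Suc i mod 4} | i. i < 4} = {{0, 1}, {1, 2}, {2, 3}, {3, 0 :: nat}}"
    unfolding lt4 by (simp only: image_insert image_empty)
  then have "(\<lambda>e. f ` e) ` p = {{i, Suc i mod 4} | i. i < 4}"
    unfolding p using fv by auto
  with bij show ?thesis unfolding isomorphic_def graph_of_def cycle_graph_def
    by (intro exI[of _ f]) simp
qed

section \<open>Disjoint stars have the arrow property\<close>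

lemma edge_set_star: "finite L \<Longrightarrow> c \<notin> L \<Longrightarrow> edge_set (star_edges c L)"
  unfolding edge_set_def star_edges_def by (auto simp: card_insert_if)

lemma substars_mono_copy:
  assumes E: "edge_set E" and P: "decomposition P E" and A: "A \<subseteq> P" "s \<le> card A" and n: "1 \<le> n"
    and sub: "\<And>p. p \<in> A \<Longrightarrow> \<exists>q. q \<subseteq> p \<and> is_star n q \<and> (\<forall>e\<in>q. c e = col)"
  shows "mono_copy (graph_of E) c col (copies s (star_graph n))"
proof -
  have fP: "finite P" and UP: "\<Union>P = E" and disj: "\<And>p q. p \<in> P \<Longrightarrow> q \<in> P \<Longrightarrow> p \<noteq> q \<Longrightarrow> \<Union>p \<inter> \<Union>q = {}"
    using P unfolding decomposition_def by auto
  obtain B where B: "B \<subseteq> A" "card B = s" "finite B"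
    using obtain_subset_with_card_n[OF A(2)] by metis
  have "\<exists>g. \<forall>p\<in>A. g p \<subseteq> p \<and> is_star n (g p) \<and> (\<forall>e\<in>g p. c e = col)"
    using sub by (intro bchoice ballI)
  then obtain g where g0: "\<forall>p\<in>A. g p \<subseteq> p \<and> is_star n (g p) \<and> (\<forall>e\<in>g p. c e = col)" ..
  have g: "g p \<subseteq> p" "is_star n (g p)" "\<And>e. e \<in> g p \<Longrightarrow> c e = col" and BP: "p \<in> P" if "p \<in> B" for p
    using g0 that B(1) A(1) by auto
  have ne: "\<Union>(g p) \<noteq> {}" if p: "p \<in> B" for p
  proof -
    obtain x L where L: "card L = n" "g p = star_edges x L" using g(2)[OF p] unfolding is_star_def by auto
    then have "L \<noteq> {}" using n by auto
    then show ?thesis using L(2) by (simp add: Union_star_edges)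
  qed
  have disj': "\<Union>(g p) \<inter> \<Union>(g q) = {}" if "p \<in> B" "q \<in> B" "p \<noteq> q" for p q
    using disj[OF BP[OF that(1)] BP[OF that(2)] that(3)] g(1)[OF that(1)] g(1)[OF that(2)]
      Union_mono[of "g p" p] Union_mono[of "g q" q] by blast
  have "inj_on g B"
  proof (rule inj_onI)
    fix p q assume pq: "p \<in> B" "q \<in> B" "g p = g q"
    show "p = q"
    proof (rule ccontr)
      assume "p \<noteq> q"
      then show False using disj'[OF pq(1,2)] pq(3) ne[OF pq(1)] by simp
    qed
  qed
  then have cP': "card (g ` B) = s" using B by (simp add: card_image)
  let ?F = "\<Union>(g ` B)"
  have FE: "?F \<subseteq> E" using g(1) BP UP by blast
  have F: "edge_set ?F" by (rule edge_set_subset[OF E FE])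
  have "decomposition (g ` B) ?F"
    unfolding decomposition_def using B(3) disj' by auto
  then have "graph_of ?F \<simeq> copies s (star_graph n)"
    using decomposition_isomorphic_copies[of "g ` B" ?F "star_graph n"] g(2) star_isomorphic[OF _ n] cP' by auto
  moreover have "subgraph (graph_of ?F) (graph_of E)"
    unfolding subgraph_def using simple_graph_of[OF F] FE Union_mono[OF FE] by (simp add: graph_of_def)
  moreover have "\<forall>e\<in>edges (graph_of ?F). c e = col" using g(3) by (auto simp: graph_of_def)
  ultimately show ?thesis unfolding mono_copy_def by blast
qed

text \<open>In each star with \<open>n + m - 1\<close> edges there are \<open>n\<close> red or \<open>m\<close> blue edges. Among \<open>s + t - 1\<close> stars the
  first happens \<open>s\<close> times or the second \<open>t\<close> times.\<close>

lemma star_forest_arrows: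
  assumes E: "edge_set E" and P: "decomposition P E" "\<And>p. p \<in> P \<Longrightarrow> is_star (n + m - 1) p"
    and cP: "card P = s + t - 1" and pos: "1 \<le> s" "1 \<le> t" "1 \<le> n" "1 \<le> m"
  shows "arrows (graph_of E) (copies s (star_graph n)) (copies t (star_graph m))"
  unfolding arrows_def
proof
  fix c
  define A where "A = {p \<in> P. \<exists>q. q \<subseteq> p \<and> is_star n q \<and> (\<forall>e\<in>q. c e = Red)}"
  have fP: "finite P" using P(1) unfolding decomposition_def by simp
  have AP: "A \<subseteq> P" unfolding A_def by auto
  show "mono_copy (graph_of E) c Red (copies s (star_graph n)) \<or> mono_copy (graph_of E) c Blue (copies t (star_graph m))"
  proof (cases "s \<le> card A")
    case True
    have "mono_copy (graph_of E) c Red (copies s (star_graph n))"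
      by (rule substars_mono_copy[OF E P(1) AP True pos(3)]) (simp add: A_def)
    then show ?thesis ..
  next
    case False
    have cB: "t \<le> card (P - A)" using False cP AP fP finite_subset[OF AP fP] by (simp add: card_Diff_subset)
    have "mono_copy (graph_of E) c Blue (copies t (star_graph m))"
    proof (rule substars_mono_copy[OF E P(1) _ cB pos(4)])
      fix p assume p: "p \<in> P - A"
      then obtain x L where L: "finite L" "card L = n + m - 1" "x \<notin> L" "p = star_edges x L"
        using P(2)[of p] unfolding is_star_def by auto
      define L1 where "L1 = {l \<in> L. c {x, l} = Red}"
      have sub: "star_edges x L' \<subseteq> p" if "L' \<subseteq> L" for L' using that L(4) unfolding star_edges_def by auto
      have "card L1 < n"
      proof (rule ccontr)
        assume "\<not> card L1 < n"
        then have "n \<le> card L1" by simp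
        then obtain L' where L': "L' \<subseteq> L1" "card L' = n" "finite L'"
          using obtain_subset_with_card_n by metis
        have "star_edges x L' \<subseteq> p" by (rule sub) (use L' L1_def in auto)
        moreover have "is_star n (star_edges x L')"
          unfolding is_star_def using L' L(3) by (intro exI[of _ x] exI[of _ L']) (auto simp: L1_def)
        moreover have "\<forall>e\<in>star_edges x L'. c e = Red" using L' unfolding star_edges_def L1_def by auto
        ultimately have "p \<in> A" using p unfolding A_def by blast
        then show False using p by simp
      qed
      moreover have "card (L - L1) = card L - card L1"
        using L(1) by (intro card_Diff_subset) (auto simp: L1_def)
      ultimately have "m \<le> card (L - L1)" using L(2) by linarith
      then obtain L' where L': "L' \<subseteq> L - L1" "card L' = m" "finite L'"
        using obtain_subset_with_card_n by metis
      have "c e = Blue" if e: "e \<in> star_edges x L'" for e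
      proof -
        obtain l where "l \<in> L'" "e = {x, l}" using e unfolding star_edges_def by blast
        then have "c e \<noteq> Red" using L' unfolding L1_def by auto
        then show ?thesis using colour.exhaust by blast
      qed
      moreover have "star_edges x L' \<subseteq> p" by (rule sub) (use L' in auto)
      moreover have "is_star m (star_edges x L')"
        unfolding is_star_def using L' L(3) by (intro exI[of _ x] exI[of _ L']) auto
      ultimately show "\<exists>q. q \<subseteq> p \<and> is_star m q \<and> (\<forall>e\<in>q. c e = Blue)" by blast
    qed auto
    then show ?thesis ..
  qed
qed

lemma ex_star_forest:
  assumes k: "1 \<le> k"
  shows "\<exists>(E :: nat set set) P. edge_set E \<and> decomposition P E \<and> (\<forall>p\<in>P. is_star k p) \<and> card P = N \<and> card E = N * k"
proof -
  define z :: "nat \<Rightarrow> nat \<Rightarrow> nat" where "z i j = prod_encode (i, j)" for i j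
  have z: "z i j = z i' j' \<longleftrightarrow> i = i' \<and> j = j'" for i j i' j'
    unfolding z_def by simp
  define p where "p i = star_edges (z i 0) (z i ` {1..k})" for i
  have Up: "\<Union>(p i) = z i ` {0..k}" for i
  proof -
    have "\<Union>(p i) = insert (z i 0) (z i ` {1..k})" unfolding p_def using k by (intro Union_star_edges) auto
    also have "\<dots> = z i ` insert 0 {1..k}" by (rule image_insert[symmetric])
    also have "insert 0 {1..k} = {0..k}" by auto
    finally show ?thesis .
  qed
  have c0: "z i 0 \<notin> z i ` {1..k}" for i by (auto simp: z)
  have ck: "card (z i ` {1..k}) = k" for i by (subst card_image) (auto simp: inj_on_def z)
  have star: "is_star k (p i)" for i
    unfolding is_star_def p_def using c0 ck by (intro exI[of _ "z i 0"] exI[of _ "z i ` {1..k}"]) simp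
  have disj: "\<Union>(p i) \<inter> \<Union>(p j) = {}" if "i \<noteq> j" for i j unfolding Up using that by (auto simp: z)
  have inj: "inj p"
  proof (rule injI)
    fix i j assume "p i = p j"
    then have "z i ` {0..k} = z j ` {0..k}" using Up[of i] Up[of j] by simp
    then have "z i 0 \<in> z j ` {0..k}" by auto
    then show "i = j" by (auto simp: z)
  qed
  let ?P = "p ` {..<N}"
  let ?E = "\<Union>?P"
  have P: "decomposition ?P ?E"
    unfolding decomposition_def
  proof (intro conjI ballI impI)
    fix q r assume "q \<in> ?P" "r \<in> ?P" "q \<noteq> r"
    then obtain i j where "q = p i" "r = p j" "i \<noteq> j" by blast
    then show "\<Union>q \<inter> \<Union>r = {}" using disj[of i j] by simp
  qed simp_all
  have E: "edge_set ?E"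
    unfolding edge_set_def
  proof (intro conjI ballI)
    show "finite ?E" unfolding p_def star_edges_def by auto
    fix e assume "e \<in> ?E"
    then obtain i where "e \<in> p i" by auto
    then show "card e = 2" using edge_set_star[OF _ c0, of i] unfolding p_def edge_set_def by auto
  qed
  have cP: "card ?P = N" using inj by (simp add: card_image inj_on_subset)
  have "card ?E = (\<Sum>q\<in>?P. card q)" by (rule decomposition_sum_card[OF E P subset_refl])
  also have "\<dots> = (\<Sum>q\<in>?P. k)"   proof (rule sum.cong)
    fix q assume "q \<in> ?P"
    then obtain i where "q = p i" by blast
    then show "card q = k" unfolding p_def by (simp only: card_star_edges ck)
  qed simp
  also have "\<dots> = N * k" using cP by simp
  finally show ?thesis using E P star cP by (intro exI[of _ ?E] exI[of _ ?P]) auto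
qed

section \<open>The size Ramsey number and the extremal graphs\<close>

lemma decomposition_two_kinds:
  assumes E: "edge_set E" and P: "decomposition P E" and P1: "P1 \<subseteq> P"
    and A: "\<And>p. p \<in> P1 \<Longrightarrow> graph_of p \<simeq> A" and B: "\<And>p. p \<in> P - P1 \<Longrightarrow> graph_of p \<simeq> B"
  shows "graph_of E \<simeq> copies (card P1) A \<squnion>\<^sub>g copies (card (P - P1)) B"
proof -
  have sub: "decomposition Q (\<Union>Q)" if "Q \<subseteq> P" for Q
    using P finite_subset[OF that] that unfolding decomposition_def by blast
  have "\<Union>(\<Union>P1) \<inter> \<Union>(\<Union>(P - P1)) = {}"
  proof (rule ccontr)
    assume "\<Union>(\<Union>P1) \<inter> \<Union>(\<Union>(P - P1)) \<noteq> {}"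
    then obtain v where "v \<in> \<Union>(\<Union>P1)" "v \<in> \<Union>(\<Union>(P - P1))" by blast
    then obtain p q where pq: "p \<in> P1" "v \<in> \<Union>p" "q \<in> P - P1" "v \<in> \<Union>q" by blast
    then have "p \<noteq> q" "p \<in> P" "q \<in> P" using P1 by auto
    then have "\<Union>p \<inter> \<Union>q = {}" using P unfolding decomposition_def by simp
    then show False using pq(2,4) by blast
  qed
  then have "graph_of (\<Union>P1 \<union> \<Union>(P - P1)) \<simeq> copies (card P1) A \<squnion>\<^sub>g copies (card (P - P1)) B"
    by (intro isomorphic_disjoint_union decomposition_isomorphic_copies sub A B P1) auto
  moreover have "\<Union>P1 \<union> \<Union>(P - P1) = E" using P P1 unfolding decomposition_def by blast
  ultimately show ?thesis by simp
qed

text \<open>The pieces are counted by comparing numbers of edges: with \<open>l\<close> pieces other than stars, there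
  are \<open>s + t - 1 - l\<close> stars besides triangles, and \<open>s + t - 1 - 2 l\<close> besides four-cycles.\<close>

lemma extremal_graphs:
  fixes G :: "'a ugraph"
  assumes pos: "s \<ge> 1" "t \<ge> 1" "m \<ge> 1" "n \<ge> 1" "n \<ge> m"
    and G: "simple_graph G" and arr: "arrows G (copies s (star_graph n)) (copies t (star_graph m))"
    and cE: "card (edges G) = (s + t - 1) * (m + n - 1)"
  shows "G \<simeq> copies (s + t - 1) (star_graph (n + m - 1)) \<or>
         (n = 2 \<and> m = 2 \<and>
           (\<exists>l \<le> s + t - 1. G \<simeq> copies l (complete_graph 3) \<squnion>\<^sub>g copies (s + t - l - 1) (star_graph 3))) \<or>
         (s = 1 \<and> m = 1 \<and> n = 2 \<and>
           (\<exists>l. 2 * l \<le> t \<and> G \<simeq> copies l (cycle_graph 4) \<squnion>\<^sub>g copies (t - 2 * l) (star_graph 2)))"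
proof -
  let ?E = "edges G" and ?N = "s + t - 1" and ?a = "n - 1" and ?b = "m - 1"
  have E: "edge_set ?E" by (rule simple_graph_edge_set[OF G])
  have k: "?a + ?b + 1 = n + m - 1" "m + n - 1 = n + m - 1" using pos by auto
  have cE': "card ?E = ?N * (?a + ?b + 1)" using cE unfolding k .
  have rob: "robust ?a ?b ?N ?E" by (rule arrows_robust[OF G arr pos(1-4)])
  have ab: "?b \<le> ?a" using pos(5) by simp
  have "\<exists>P. decomposition P ?E \<and> (\<forall>p\<in>P. piece ?a ?b p)"
    by (rule extremal_decomposition[OF E ab rob cE'])
  then obtain P where P: "decomposition P ?E" and pcs: "\<And>p. p \<in> P \<Longrightarrow> piece ?a ?b p" by blast
  have fP: "finite P" using P unfolding decomposition_def by simp
  have sumP: "card ?E = (\<Sum>p\<in>P. card p)"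
    using decomposition_sum_card[OF E P subset_refl] P unfolding decomposition_def by simp
  have card_star: "card p = j" if "is_star j p" for j and p :: "'a set set"
    using that card_star_edges unfolding is_star_def by metis
  have nocol: "False" if "\<not> mono_copy G c Red (copies s (star_graph n))" "\<not> mono_copy G c Blue (copies t (star_graph m))" for c
    using arr that unfolding arrows_def by blast
  show ?thesis
  proof (cases "\<forall>p\<in>P. is_star (n + m - 1) p")
    case True
    have "(\<Sum>p\<in>P. card p) = (\<Sum>p\<in>P. n + m - 1)" using card_star True by (intro sum.cong) simp_all
    then have "card ?E = card P * (n + m - 1)" using sumP by simp
    then have "card P * (n + m - 1) = ?N * (n + m - 1)" using cE' unfolding k(1) by (rule HOL.trans[OF sym])
    moreover have "n + m - 1 \<noteq> 0" using pos by simp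
    ultimately have "card P = ?N" by (simp only: mult_cancel2 simp_thms)
    moreover have "graph_of ?E \<simeq> copies (card P) (star_graph (n + m - 1))"
      by (rule decomposition_isomorphic_copies[OF P], rule star_isomorphic) (use True pos in auto)
    ultimately show ?thesis using graph_of_edges[OF G] by simp
  next
    case False
    then obtain p0 where p0: "p0 \<in> P" "\<not> is_star (n + m - 1) p0" by blast
    have split: "card ?E = (\<Sum>p\<in>P1. card p) + (\<Sum>p\<in>P - P1. card p)" if "P1 \<subseteq> P" for P1
      using sumP fP that by (simp add: sum.subset_diff)
    have le: "card p \<le> card ?E" if "p \<in> P" for p
      unfolding sumP using fP that by (intro member_le_sum) auto
    have "(?a = 1 \<and> ?b = 1) \<or> (?a = 1 \<and> ?b = 0 \<and> is_four_cycle p0)"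
      using pcs[OF p0(1)] p0(2) unfolding piece_def k by blast
    then consider (triangles) "n = 2" "m = 2" | (cycles) "n = 2" "m = 1" "is_four_cycle p0"
      using pos by fastforce
    then show ?thesis
    proof cases
      case triangles
      have no4: "\<not> is_complete 4 p" if p: "p \<in> P" for p
      proof
        assume "is_complete 4 p"
        then obtain Q where Q: "finite Q" "card Q = 4" "p = complete_edges Q" unfolding is_complete_def by blast
        have c6: "card p = 6" using Q by (simp add: card_complete_edges choose_two)
        have c4: "card (\<Union>p) = 4" using Q by (simp add: Union_complete_edges)
        have "2 \<le> ?N" using le[OF p] c6 cE' triangles by simp
        then consider "2 \<le> s" | "2 \<le> t" using pos by linarith
        then show False
        proof cases
          case 1
          have "\<exists>c. \<not> mono_copy G c Red (copies s (star_graph n)) \<and> \<not> mono_copy G c Blue (copies t (star_graph m))"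
            by (rule colouring_with_four_vertex_piece[OF G _ P pcs p c4 _ cE' 1 pos(2)])
              (use triangles c6 in auto)
          then show False using nocol by blast
        next
          case 2
          have "\<exists>c. \<not> mono_copy G c Blue (copies t (star_graph m)) \<and> \<not> mono_copy G c Red (copies s (star_graph n))"
            by (rule colouring_with_four_vertex_piece[OF G _ P pcs p c4 _ _ 2 pos(1)])
              (use triangles c6 cE' in \<open>auto simp: add.commute\<close>)
          then show False using nocol by blast
        qed
      qed
      define P1 where "P1 = {p \<in> P. is_complete 3 p}"
      have P1: "P1 \<subseteq> P" unfolding P1_def by auto
      have c3: "is_complete 3 p" if "p \<in> P1" for p using that unfolding P1_def by simp
      have s3: "is_star 3 p" if "p \<in> P - P1" for p
        using pcs[of p] no4[of p] that triangles unfolding piece_def P1_def by (auto simp: eval_nat_numeral)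
      have "card p = 3" if p: "p \<in> P1" for p
      proof -
        obtain Q where "finite Q" "card Q = 3" "p = complete_edges Q"
          using c3[OF p] unfolding is_complete_def by blast
        then show ?thesis by (simp add: card_complete_edges choose_two)
      qed
      then have "(\<Sum>p\<in>P1. card p) = (\<Sum>p\<in>P1. 3)" by (intro sum.cong refl)
      moreover have "(\<Sum>p\<in>P - P1. card p) = (\<Sum>p\<in>P - P1. 3)" by (intro sum.cong refl card_star s3)
      ultimately
      have "card ?E = card P1 * 3 + card (P - P1) * 3" using split[OF P1] by simp
      then have "card P1 + card (P - P1) = ?N" using cE triangles by simp
      then have l: "card P1 \<le> ?N" "card (P - P1) = s + t - card P1 - 1" by linarith+
      have "graph_of ?E \<simeq> copies (card P1) (complete_graph 3) \<squnion>\<^sub>g copies (card (P - P1)) (star_graph 3)"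
        by (rule decomposition_two_kinds[OF E P P1 complete_isomorphic[OF c3] star_isomorphic[OF s3]]) simp_all
      then have "G \<simeq> copies (card P1) (complete_graph 3) \<squnion>\<^sub>g copies (s + t - card P1 - 1) (star_graph 3)"
        unfolding l(2) graph_of_edges[OF G] .
      then show ?thesis using triangles l(1) by blast
    next
      case cycles
      have s1: "s = 1"
      proof (rule ccontr)
        assume "s \<noteq> 1"
        then have s2: "2 \<le> s" using pos by simp
        have "\<exists>c. \<not> mono_copy G c Red (copies s (star_graph n)) \<and> \<not> mono_copy G c Blue (copies t (star_graph m))"
          by (rule colouring_with_four_vertex_piece[OF G _ P pcs p0(1) _ _ cE' s2 pos(2)])
            (use cycles four_cycle_cards[OF cycles(3)] in auto)
        then show False using nocol by blast
      qed
      define P1 where "P1 = {p \<in> P. is_four_cycle p}"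
      have P1: "P1 \<subseteq> P" unfolding P1_def by auto
      have c4: "is_four_cycle p" if "p \<in> P1" for p using that unfolding P1_def by simp
      have s2: "is_star 2 p" if "p \<in> P - P1" for p
        using pcs[of p] that cycles unfolding piece_def P1_def by (auto simp: eval_nat_numeral)
      have "(\<Sum>p\<in>P1. card p) = (\<Sum>p\<in>P1. 4)" by (intro sum.cong refl four_cycle_cards(1) c4)
      moreover have "(\<Sum>p\<in>P - P1. card p) = (\<Sum>p\<in>P - P1. 2)" by (intro sum.cong refl card_star s2)
      ultimately have "card ?E = card P1 * 4 + card (P - P1) * 2" using split[OF P1] by simp
      then have "2 * card P1 + card (P - P1) = t" using cE cycles s1 by simp
      then have l: "2 * card P1 \<le> t" "card (P - P1) = t - 2 * card P1" by linarith+
      have "graph_of ?E \<simeq> copies (card P1) (cycle_graph 4) \<squnion>\<^sub>g copies (card (P - P1)) (star_graph 2)"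
        by (rule decomposition_two_kinds[OF E P P1 four_cycle_isomorphic[OF c4] star_isomorphic[OF s2]]) simp_all
      then have "G \<simeq> copies (card P1) (cycle_graph 4) \<squnion>\<^sub>g copies (t - 2 * card P1) (star_graph 2)"
        unfolding l(2) graph_of_edges[OF G] .
      then show ?thesis using cycles s1 l(1) by blast
    qed
  qed
qed

theorem theorem2p2:
  fixes s t m n :: nat
  assumes "s \<ge> 1" "t \<ge> 1" "m \<ge> 1" "n \<ge> 1" "n \<ge> m"
  shows "size_ramsey (copies s (star_graph n)) (copies t (star_graph m)) = enat ((s + t - 1) * (m + n - 1)) \<and>
    (\<forall>G :: 'a ugraph.
       simple_graph G \<and> arrows G (copies s (star_graph n)) (copies t (star_graph m)) \<and>
       card (edges G) = (s + t - 1) * (m + n - 1) \<longrightarrow>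
         G \<simeq> copies (s + t - 1) (star_graph (n + m - 1)) \<or>
         (n = 2 \<and> m = 2 \<and>
           (\<exists>l \<le> s + t - 1. G \<simeq> copies l (complete_graph 3) \<squnion>\<^sub>g copies (s + t - l - 1) (star_graph 3))) \<or>
         (s = 1 \<and> m = 1 \<and> n = 2 \<and>
           (\<exists>l. 2 * l \<le> t \<and> G \<simeq> copies l (cycle_graph 4) \<squnion>\<^sub>g copies (t - 2 * l) (star_graph 2))))"
proof (intro conjI allI impI)
  let ?F1 = "copies s (star_graph n)" and ?F2 = "copies t (star_graph m)" and ?N = "s + t - 1"
  have k: "n - 1 + (m - 1) + 1 = m + n - 1" using assms by simp
  show "size_ramsey ?F1 ?F2 = enat (?N * (m + n - 1))"
  proof (rule antisym)
    have "1 \<le> n + m - 1" using assms by simp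
    then obtain E P where EP: "edge_set (E :: nat set set)" "decomposition P E"
        "\<forall>p\<in>P. is_star (n + m - 1) p" "card P = ?N" "card E = ?N * (n + m - 1)"
      using ex_star_forest[of "n + m - 1" ?N] by blast
    have "arrows (graph_of E) ?F1 ?F2"
      by (rule star_forest_arrows[OF EP(1,2) _ EP(4)]) (use EP(3) assms in auto)
    then have "graph_of E \<in> {G. simple_graph G \<and> arrows G ?F1 ?F2}"
      using simple_graph_of[OF EP(1)] by simp
    then have "size_ramsey ?F1 ?F2 \<le> enat (card (edges (graph_of E)))"
      unfolding size_ramsey_def by (rule INF_lower)
    then show "size_ramsey ?F1 ?F2 \<le> enat (?N * (m + n - 1))"
      using EP(5) by (simp add: graph_of_def add.commute)
    show "enat (?N * (m + n - 1)) \<le> size_ramsey ?F1 ?F2"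
      unfolding size_ramsey_def
    proof (rule INF_greatest)
      fix G :: "nat ugraph" assume "G \<in> {G. simple_graph G \<and> arrows G ?F1 ?F2}"
      then have G: "simple_graph G" "arrows G ?F1 ?F2" by auto
      have "robust (n - 1) (m - 1) ?N (edges G)" by (rule arrows_robust[OF G assms(1-4)])
      then have "?N * (n - 1 + (m - 1) + 1) \<le> card (edges G)"
        using assms(5) by (intro robust_card_ge simple_graph_edge_set[OF G(1)]) simp_all
      then show "enat (?N * (m + n - 1)) \<le> enat (card (edges G))" unfolding k by simp
    qed
  qed
qed (use extremal_graphs[OF assms] in blast)

end
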